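(* Let $\rho^1<\rho^2<\rho^3$ be real constants. There is a constant $C=C(\rho^1,\rho^2,\rho^3)$, depending only on $\rho^1,\rho^2,\rho^3$, such that the following holds. Let $0<\gamma<1$, let $C_\infty\in\mathbb{R}$, and let $(f,g)$ be a solution of the contour system $$ \begin{aligned} f_t(x,t)=&\frac{\rho^2-\rho^1}{4\pi}\,PV\!\int_{\mathbb{R}^2}\frac{(\nabla f(x,t)-\nabla f(x-y,t))\cdot y}{[|y|^2+(f(x,t)-f(x-y,t))^2]^{3/2}}\,dy\\ &+\frac{\rho^3-\rho^2}{4\pi}\,PV\!\int_{\mathbb{R}^2}\frac{\nabla f(x,t)\cdot y-\nabla g(x-y,t)\cdot y}{[|y|^2+(f(x,t)-g(x-y,t))^2]^{3/2}}\,dy,\\ g_t(x,t)=&\frac{\rho^3-\rho^2}{4\pi}\,PV\!\int_{\mathbb{R}^2}\frac{(\nabla g(x,t)-\nabla g(x-y,t))\cdot y}{[|y|^2+(g(x,t)-g(x-y,t))^2]^{3/2}}\,dy\\ &+\frac{\rho^2-\rho^1}{4\pi}\,PV\!\int_{\mathbb{R}^2}\frac{\nabla g(x,t)\cdot y-\nabla f(x-y,t)\cdot y}{[|y|^2+(g(x,t)-f(x-y,t))^2]^{3/2}}\,dy, \end{aligned} $$ with $f(x,t)>g(x,t)$ for all $x\in\mathbb{R}^2$, $f(x,t)\to C_\infty$ and $g(x,t)\to 0$ as $|x|\to\infty$, for which the norms on the right-hand side below are finite. Then, at each time $t$ of existence, the associated fluid velocity $u=u(\cdot,t)$ on $\mathbb{R}^3$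 (defined in the context) satisfies $$ \begin{aligned} \|u\|_{L^\infty}\le C\Big(1&+\frac1\gamma+\frac1\gamma\ln\big(1+\|\nabla f\|_{C^\gamma}+\|\nabla g\|_{C^\gamma}\big)\\ &+\ln\big(1+\|f-C_\infty\|_{L^\infty}+C_\infty+\|\nabla f\|_{L^2}+\|g\|_{L^\infty}+\|\nabla g\|_{L^2}\big)\Big), \end{aligned} $$ where all norms of $f$ and $g$ are over $\mathbb{R}^2$ at time $t$.
   Context: Here $x,y\in\mathbb{R}^2$, $\nabla=(\partial_{x_1},\partial_{x_2})$, and $PV$ denotes the principal value, i.e. $\lim_{\varepsilon\to0,\,R\to\infty}\int_{\varepsilon<|y|<R}$. $\|\cdot\|_{C^\gamma}$ is the usual Hölder norm with exponent $\gamma$ on $\mathbb{R}^2$. The fluid density is $\rho(x,x_3,t)=\rho^1$ if $x_3>f(x,t)$, $\rho^2$ if $g(x,t)<x_3<f(x,t)$, and $\rho^3$ if $x_3<g(x,t)$. The velocity $u$ is the incompressible field determined by $\rho$ through Darcy's law $u=-\nabla p-(0,0,\rho)$, $\nabla\cdot u=0$ in $\mathbb{R}^3$, that is $$u=\big(\partial_{x_1}\Delta^{-1}\partial_{x_3}\rho,\ \partial_{x_2}\Delta^{-1}\partial_{x_3}\rho,\ -\partial_{x_1}\Delta^{-1}\partial_{x_1}\rho-\partial_{x_2}\Delta^{-1}\partial_{x_2}\rho\big).$$ Explicitly, for $(x,x_3)\in\mathbb{R}^3$ with $x=(x_1,x_2)$ and $x_3\ne f(x,t)$, $x_3\neq g(x,t)$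 (hence for almost every point of $\mathbb{R}^3$), $$ \begin{aligned} u(x,x_3,t)=&-\frac{\rho^2-\rho^1}{4\pi}\,PV\!\int_{\mathbb{R}^2}\frac{(y_1,\,y_2,\,\nabla f(x-y,t)\cdot y)}{[|y|^2+(x_3-f(x-y,t))^2]^{3/2}}\,dy\\ &-\frac{\rho^3-\rho^2}{4\pi}\,PV\!\int_{\mathbb{R}^2}\frac{(y_1,\,y_2,\,\nabla g(x-y,t)\cdot y)}{[|y|^2+(x_3-g(x-y,t))^2]^{3/2}}\,dy . \end{aligned} $$ $\|u\|_{L^\infty}$ is the essential supremum of $|u(\cdot,t)|$ over $\mathbb{R}^3$. *)

theory Defs
  imports "HOL-Analysis.Analysis" "HOL-Probability.Essential_Supremum"
begin

definition grad :: "('a::real_inner \<Rightarrow> real) \<Rightarrow> 'a \<Rightarrow> 'a" where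
  "grad h x = (THE D. GDERIV h x :> D)"

definition annulus :: "real \<Rightarrow> real \<Rightarrow> 'a::real_normed_vector set" where
  "annulus \<epsilon> R = {y. \<epsilon> < norm y \<and> norm y < R}"

definition has_pv_integral ::
  "('a::euclidean_space \<Rightarrow> 'b::{banach, second_countable_topology}) \<Rightarrow> 'b \<Rightarrow> bool" where
  "has_pv_integral F l \<longleftrightarrow>
     (\<forall>\<epsilon> R. 0 < \<epsilon> \<and> \<epsilon> < R \<longrightarrow> set_integrable lebesgue (annulus \<epsilon> R) F) \<and>
     ((\<lambda>(\<epsilon>, R). LINT y:annulus \<epsilon> R|lebesgue. F y) \<longlongrightarrow> l) (at_right 0 \<times>\<^sub>F at_top)"

text \<open>No default value is chosen: a statement about \<open>pv_integral F\<close> has content only once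
  the principal value is known to exist.\<close>

definition pv_integral ::
  "('a::euclidean_space \<Rightarrow> 'b::{banach, second_countable_topology}) \<Rightarrow> 'b" where
  "pv_integral F = (THE l. has_pv_integral F l)"

text \<open>All norms take values in the extended reals, \<open>\<infinity>\<close> meaning that the function does not
  belong to the space in question.\<close>

definition Linf_norm :: "('a::euclidean_space \<Rightarrow> 'b::real_normed_vector) \<Rightarrow> ereal" where
  "Linf_norm h = esssup lebesgue (\<lambda>x. ereal (norm (h x)))"

definition L2_norm :: "('a::euclidean_space \<Rightarrow> 'b::real_normed_vector) \<Rightarrow> ereal" where
  "L2_norm h =
     (if h \<in> borel_measurable lebesgue \<and> integrable lebesgue (\<lambda>x. (norm (h x))\<^sup>2)
      then ereal (sqrt (LINT x|lebesgue. (norm (h x))\<^sup>2)) else \<infinity>)"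

definition holder_norm ::
  "real \<Rightarrow> ('a::real_normed_vector \<Rightarrow> 'b::real_normed_vector) \<Rightarrow> ereal" where
  "holder_norm \<gamma> h =
     (SUP x. ereal (norm (h x))) +
     (SUP (x, y) \<in> {(x, y). x \<noteq> y}. ereal (norm (h x - h y) / norm (x - y) powr \<gamma>))"

text \<open>The integrand of the contour system: the surface \<open>h\<close>, at the point above \<open>x\<close>, is
  moved by the surface \<open>k\<close> (where \<open>k = h\<close> is allowed).\<close>

definition contour_kernel ::
  "(real^2 \<Rightarrow> real) \<Rightarrow> (real^2 \<Rightarrow> real) \<Rightarrow> real^2 \<Rightarrow> real^2 \<Rightarrow> real" where
  "contour_kernel h k x y =
     ((grad h x - grad k (x - y)) \<bullet> y) /
     ((norm y)\<^sup>2 + (h x - k (x - y))\<^sup>2) powr (3/2)"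

text \<open>The functions \<open>f\<close> and \<open>g\<close> take time as their first argument, so that \<open>f t\<close> is the
  surface at time \<open>t\<close>.  The set \<open>I\<close> is the time interval of existence; time derivatives are
  one-sided at those end points that belong to it.\<close>

definition contour_solution ::
  "real \<Rightarrow> real \<Rightarrow> real \<Rightarrow> real set \<Rightarrow> (real \<Rightarrow> real^2 \<Rightarrow> real) \<Rightarrow> (real \<Rightarrow> real^2 \<Rightarrow> real) \<Rightarrow> bool"
where
  "contour_solution \<rho>1 \<rho>2 \<rho>3 I f g \<longleftrightarrow>
     is_interval I \<and> interior I \<noteq> {} \<and>
     (\<forall>t\<in>I. \<forall>x. f t differentiable (at x) \<and> g t differentiable (at x)) \<and>
     (\<forall>t\<in>I. \<forall>x. \<exists>ff fg gg gf.
        has_pv_integral (contour_kernel (f t) (f t) x) ff \<and>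
        has_pv_integral (contour_kernel (f t) (g t) x) fg \<and>
        has_pv_integral (contour_kernel (g t) (g t) x) gg \<and>
        has_pv_integral (contour_kernel (g t) (f t) x) gf \<and>
        ((\<lambda>s. f s x) has_real_derivative
           (\<rho>2 - \<rho>1) / (4 * pi) * ff + (\<rho>3 - \<rho>2) / (4 * pi) * fg) (at t within I) \<and>
        ((\<lambda>s. g s x) has_real_derivative
           (\<rho>3 - \<rho>2) / (4 * pi) * gg + (\<rho>2 - \<rho>1) / (4 * pi) * gf) (at t within I))"

text \<open>Points and vectors \<open>(x, x\<^sub>3)\<close> of three-dimensional space are elements of
  \<open>real^2 \<times> real\<close>, whose norm and Lebesgue measure are the Euclidean ones.\<close>

definition velocity_kernel :: "(real^2 \<Rightarrow> real) \<Rightarrow> (real^2) \<times> real \<Rightarrow> real^2 \<Rightarrow> (real^2) \<times> real" where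
  "velocity_kernel h = (\<lambda>(x, x3) y.
     (y, grad h (x - y) \<bullet> y) /\<^sub>R ((norm y)\<^sup>2 + (x3 - h (x - y))\<^sup>2) powr (3/2))"

text \<open>The Darcy velocity for densities \<open>\<rho>1\<close>, \<open>\<rho>2\<close>, \<open>\<rho>3\<close> from top to bottom, separated by
  the graphs of \<open>f\<close> and \<open>g\<close>.  The formula is meaningful off the two graphs only; these form a
  Lebesgue null set.\<close>

definition velocity ::
  "real \<Rightarrow> real \<Rightarrow> real \<Rightarrow> (real^2 \<Rightarrow> real) \<Rightarrow> (real^2 \<Rightarrow> real) \<Rightarrow> (real^2) \<times> real \<Rightarrow> (real^2) \<times> real"
where
  "velocity \<rho>1 \<rho>2 \<rho>3 f g p =
     - ((\<rho>2 - \<rho>1) / (4 * pi)) *\<^sub>R pv_integral (velocity_kernel f p)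
     - ((\<rho>3 - \<rho>2) / (4 * pi)) *\<^sub>R pv_integral (velocity_kernel g p)"

end

theory Submission
  imports Defs
begin

text \<open>
  Write \<open>s y = x\<^sub>3 - f (x - y)\<close> and \<open>K Y = Y / |Y|\<^sup>3\<close> on \<open>\<real>\<^sup>2 \<times> \<real>\<close>.  The velocity kernel is
  \<open>K (y, s y)\<close> plus the vertical vector with entry \<open>(\<nabla>s \<bullet> y - s) / |(y, s y)|\<^sup>3\<close>, and that entry is
  \<open>(y \<bullet> \<nabla>\<Psi>) / |y|\<^sup>2\<close> for the bounded function \<open>\<Psi> = s / |(y, s y)|\<close>.  Since the integral of
  \<open>\<Psi> / |y|\<^sup>2\<close> over an annulus changes only through boundary layers when the annulus is rescaled, the
  integral of this radial derivative is at most \<open>4\<pi>\<close>, whatever the slope of \<open>s\<close>.  No gradient of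
  \<open>f\<close> is left in \<open>K (y, s y)\<close>, so the two logarithms are all that remains: for
  \<open>|y| < (1 + H) powr (-1/\<gamma>)\<close>, where \<open>H\<close> is the Hoelder norm, \<open>s\<close> is compared with its linearisation
  at \<open>0\<close>; for \<open>|y| > 1 + L\<close>, where \<open>L\<close> bounds \<open>|f|\<close>, it is compared with the constant \<open>x\<^sub>3\<close>; in between
  \<open>|K (y, s y)| \<le> 1 / |y|\<^sup>2\<close>.  For affine \<open>s\<close> the bound uses the scaling argument once more, together
  with the oddness of \<open>K\<close>.  The \<open>L\<^sup>2\<close> norm of the gradient serves only to show that the principal value exists.
\<close>

subsection \<open>Radial integrals on the plane\<close>

text \<open>Both measures give \<open>{..a}\<close> the area of the disc of radius \<open>a\<close>,
  and these half-lines are an intersection-stable generator of the Borel sets. This stands in for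
  polar coordinates: only radial majorants are integrated exactly.\<close>

lemma distr_lborel_norm:
  "distr lborel borel (norm :: real^2 \<Rightarrow> real) =
    density lborel (\<lambda>r. ennreal (2 * pi * r) * indicator {0..} r)"
proof (rule measure_eqI_generator_eq[where E = "range atMost" and \<Omega> = UNIV and A = "\<lambda>i. {..real i}"])
  let ?M = "distr lborel borel (norm :: real^2 \<Rightarrow> real)"
  let ?N = "density lborel (\<lambda>r. ennreal (2 * pi * r) * indicator {0..} r)"
  have M: "emeasure ?M {..a} = (if a < 0 then 0 else ennreal (pi * a\<^sup>2))" for a
  proof -
    have "emeasure ?M {..a} = emeasure lborel (cball (0::real^2) a)"
      by (subst emeasure_distr) (auto intro!: arg_cong[where f = "emeasure lborel"])
    then show ?thesis by (auto simp: emeasure_cball unit_ball_vol_2)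
  qed
  have N: "emeasure ?N {..a} = (if a < 0 then 0 else ennreal (pi * a\<^sup>2))" for a
  proof (cases "a < 0")
    case True
    then have "emeasure ?N {..a} = (\<integral>\<^sup>+r. 0 \<partial>(lborel :: real measure))"
      by (subst emeasure_density, simp, simp, intro nn_integral_cong) (auto simp: indicator_def)
    with True show ?thesis by simp
  next
    case False
    have "emeasure ?N {..a} = (\<integral>\<^sup>+r. ennreal (2 * pi * r) * indicator {0..a} r \<partial>lborel)"
      by (subst emeasure_density, simp, simp, intro nn_integral_cong) (auto simp: indicator_def)
    also have "\<dots> = ennreal (pi * a\<^sup>2 - pi * 0\<^sup>2)"
      using False by (intro nn_integral_FTC_Icc) (auto intro!: derivative_eq_intros)
    finally show ?thesis using False by simp
  qed
  show "emeasure ?M X = emeasure ?N X" if "X \<in> range atMost" for X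
    using that M N by auto
  show "emeasure ?M {..real i} \<noteq> \<infinity>" for i using M by simp
  show "Int_stable (range (atMost :: real \<Rightarrow> real set))"
    by (auto simp: Int_stable_def image_iff intro!: exI[of _ "min _ _"])
  show "(\<Union>i. {..real i}) = UNIV" using real_arch_simple by auto
  show "sets ?M = sigma_sets UNIV (range atMost)" "sets ?N = sigma_sets UNIV (range atMost)"
    by (simp_all add: borel_eq_atMost)
qed auto

lemma nn_integral_radial:
  fixes w :: "real \<Rightarrow> ennreal"
  assumes [measurable]: "w \<in> borel_measurable borel"
  shows "(\<integral>\<^sup>+y. w (norm (y::real^2)) \<partial>lborel) = (\<integral>\<^sup>+r. ennreal (2 * pi * r) * indicator {0..} r * w r \<partial>lborel)"
proof -
  have "(\<integral>\<^sup>+y. w (norm (y::real^2)) \<partial>lborel) = (\<integral>\<^sup>+r. w r \<partial>distr lborel borel (norm :: real^2 \<Rightarrow> real))"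
    by (simp add: nn_integral_distr)
  then show ?thesis
    by (simp add: distr_lborel_norm nn_integral_density)
qed

text \<open>The workhorse for integrability and size estimates on planar sets. The antiderivative is
  that of \<open>r * w r\<close> because \<open>r\<close> is the Jacobian of polar coordinates; for
  \<open>w r = 1 / r\<^sup>2\<close> it is \<open>ln\<close>.\<close>

lemma radial_bound:
  fixes F :: "real^2 \<Rightarrow> 'b::{banach, second_countable_topology}"
  assumes ab: "0 \<le> a" "a \<le> b" and A: "A \<subseteq> {y. a \<le> norm y \<and> norm y \<le> b}"
    and [measurable]: "A \<in> sets borel" "F \<in> borel_measurable borel" "w \<in> borel_measurable borel"
    and F: "\<And>y. y \<in> A \<Longrightarrow> norm (F y) \<le> w (norm y)"
    and \<Phi>: "\<And>r. a \<le> r \<Longrightarrow> r \<le> b \<Longrightarrow> (\<Phi> has_real_derivative r * w r) (at r)"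
    and w: "\<And>r. a \<le> r \<Longrightarrow> r \<le> b \<Longrightarrow> 0 \<le> w r"
  shows "set_integrable lborel A F" and "norm (LINT y:A|lborel. F y) \<le> 2 * pi * (\<Phi> b - \<Phi> a)"
proof -
  \<comment> \<open>Needed to leave \<open>ennreal\<close> at the end, since \<open>ennreal\<close>
    sends negative reals to 0.\<close>
  have mono: "\<Phi> a \<le> \<Phi> b"
    by (rule DERIV_nonneg_imp_nondecreasing[OF ab(2)])
       (use \<Phi> w ab in \<open>auto intro!: exI[of _ "_ * _"] mult_nonneg_nonneg\<close>)
  have le: "ennreal (norm (indicator A y *\<^sub>R F y)) \<le> ennreal (w (norm y)) * indicator {a..b} (norm y)" for y
    using F[of y] A by (auto simp: indicator_def intro!: ennreal_leI)
  have "(\<integral>\<^sup>+y. ennreal (norm (indicator A y *\<^sub>R F y)) \<partial>lborel)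
      \<le> (\<integral>\<^sup>+y. ennreal (w (norm y)) * indicator {a..b} (norm (y::real^2)) \<partial>lborel)"
    by (intro nn_integral_mono le)
  also have "\<dots> = (\<integral>\<^sup>+r. ennreal (2 * pi * r) * indicator {0..} r * (ennreal (w r) * indicator {a..b} r) \<partial>lborel)"
    by (rule nn_integral_radial) measurable
  also have "\<dots> = (\<integral>\<^sup>+r. ennreal (2 * pi * (r * w r)) * indicator {a..b} r \<partial>lborel)"
    using ab w by (intro nn_integral_cong) (auto simp: indicator_def ennreal_mult' mult_ac simp flip: ennreal_mult')
  also have "\<dots> = ennreal (2 * pi * \<Phi> b - 2 * pi * \<Phi> a)"
    using ab w by (intro nn_integral_FTC_Icc) (auto intro!: derivative_eq_intros \<Phi>)
  finally have nn: "(\<integral>\<^sup>+y. ennreal (norm (indicator A y *\<^sub>R F y)) \<partial>lborel) \<le> ennreal (2 * pi * (\<Phi> b - \<Phi> a))"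
    by (simp add: algebra_simps)
  show int: "set_integrable lborel A F"
    unfolding set_integrable_def
    by (rule integrableI_bounded) (use nn in \<open>auto simp: less_top[symmetric] top_unique\<close>)
  have "ennreal (norm (LINT y:A|lborel. F y)) \<le> ennreal (2 * pi * (\<Phi> b - \<Phi> a))"
    using integral_norm_bound_ennreal[OF int[unfolded set_integrable_def]] nn
    unfolding set_lebesgue_integral_def by simp
  then show "norm (LINT y:A|lborel. F y) \<le> 2 * pi * (\<Phi> b - \<Phi> a)"
    using mono by (simp add: ennreal_le_iff)
qed

subsection \<open>Annuli, the kernel and rescaling\<close>

text \<open>Serves the reflection \<open>c = -1\<close> and the dilation \<open>c = 1 + h n\<close>
  of the scaling argument.\<close>

lemma lborel_affine_transfer:
  fixes h :: "'a::euclidean_space \<Rightarrow> 'b::{banach, second_countable_topology}"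
  assumes c: "c \<noteq> 0" and [measurable]: "h \<in> borel_measurable borel"
  shows lborel_integral_affine:
      "(LINT y|lborel. h y) = \<bar>c\<bar> ^ DIM('a) *\<^sub>R (LINT y|lborel. h (t + c *\<^sub>R y))"
    and lborel_integrable_affine:
      "integrable lborel h \<longleftrightarrow> integrable lborel (\<lambda>y. h (t + c *\<^sub>R y))"
proof -
  show "(LINT y|lborel. h y) = \<bar>c\<bar> ^ DIM('a) *\<^sub>R (LINT y|lborel. h (t + c *\<^sub>R y))"
    by (subst lborel_affine[OF c, of t]) (simp add: integral_density integral_distr)
  show "integrable lborel h \<longleftrightarrow> integrable lborel (\<lambda>y. h (t + c *\<^sub>R y))"
  proof -
    have "integrable lborel (\<lambda>y. \<bar>c\<bar> ^ DIM('a) *\<^sub>R h (t + c *\<^sub>R y)) \<Longrightarrow>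
        integrable lborel (\<lambda>y. (1 / \<bar>c\<bar> ^ DIM('a)) *\<^sub>R (\<bar>c\<bar> ^ DIM('a) *\<^sub>R h (t + c *\<^sub>R y)))"
      by (rule integrable_scaleR_right)
    then have "integrable lborel (\<lambda>y. \<bar>c\<bar> ^ DIM('a) *\<^sub>R h (t + c *\<^sub>R y)) \<longleftrightarrow>
        integrable lborel (\<lambda>y. h (t + c *\<^sub>R y))"
      using c by auto
    then show ?thesis
      by (subst lborel_affine[OF c, of t]) (simp add: integrable_density integrable_distr_eq)
  qed
qed

lemma set_integral_odd:
  fixes F :: "'a::euclidean_space \<Rightarrow> 'b::{banach, second_countable_topology}"
  assumes [measurable]: "A \<in> sets borel" "F \<in> borel_measurable borel"
    and A: "\<And>y. - y \<in> A \<longleftrightarrow> y \<in> A" and F: "\<And>y. F (- y) = - F y"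
  shows "(LINT y:A|lborel. F y) = 0"
proof -
  have "(LINT y:A|lborel. F y) = (LINT y|lborel. indicator A (- y) *\<^sub>R F (- y))"
    unfolding set_lebesgue_integral_def
    by (subst lborel_integral_affine[where c = "-1" and t = 0]) auto
  also have "\<dots> = - (LINT y:A|lborel. F y)"
    using A by (simp add: F indicator_def set_lebesgue_integral_def)
  finally show ?thesis by (simp add: eq_neg_iff_add_eq_0 flip: scaleR_2)
qed

lemma annulus_measurable [measurable]: "annulus a b \<in> sets (borel :: 'a::real_normed_vector measure)"
  unfolding annulus_def by (intro borel_open open_Collect_conj open_Collect_less continuous_intros)

text \<open>Annuli are open, so the two pieces miss the sphere of radius \<open>b\<close>; that
  sphere is a null set, and the indicators add up almost everywhere.\<close>

lemma annulus_integral_split: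
  fixes F :: "'a::euclidean_space \<Rightarrow> 'b::{banach, second_countable_topology}"
  assumes abc: "a \<le> b" "b \<le> c" and int: "set_integrable lborel (annulus a c) F"
  shows "(LINT y:annulus a c|lborel. F y) =
    (LINT y:annulus a b|lborel. F y) + (LINT y:annulus b c|lborel. F y)"
proof -
  have sub: "set_integrable lborel (annulus a b) F" "set_integrable lborel (annulus b c) F"
    using abc by (auto intro!: set_integrable_subset[OF int] simp: annulus_def)
  have "sphere (0::'a) b \<in> null_sets lborel"
    using negligible_sphere[of 0 b] by (simp add: negligible_iff_null_sets null_sets_completion_iff)
  then have "AE y in lborel. y \<notin> sphere (0::'a) b" by (rule AE_not_in)
  then have ae: "AE y in lborel. indicator (annulus a c) y *\<^sub>R F y =
      indicator (annulus a b) y *\<^sub>R F y + indicator (annulus b c) y *\<^sub>R F y"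
    using abc by (auto elim!: eventually_mono simp: annulus_def indicator_def)
  show ?thesis
    using integral_cong_AE[OF _ _ ae] int sub
    unfolding set_lebesgue_integral_def set_integrable_def by auto
qed

section \<open>The field \<open>K\<close> of the overview, that of a point charge, and its
  difference estimates\<close>

definition coulomb :: "'a::real_normed_vector \<Rightarrow> 'a" where
  "coulomb Y = Y /\<^sub>R norm Y ^ 3"

lemma coulomb_measurable [measurable]:
  "coulomb \<in> borel_measurable (borel :: 'a::{real_normed_vector, second_countable_topology} measure)"
  unfolding coulomb_def by measurable

lemma coulomb_minus: "coulomb (- Y) = - coulomb Y"
  by (simp add: coulomb_def)

lemma norm_coulomb: "norm (coulomb Y) = 1 / (norm Y)\<^sup>2"
  by (simp add: coulomb_def divide_simps power2_eq_square power3_eq_cube)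

text \<open>A mean value inequality for a field whose derivative has size \<open>1 / m ^ 3\<close>.
  It is proved algebraically, because the segment from \<open>X\<close> to \<open>Y\<close> may pass
  through the origin.\<close>

lemma coulomb_diff_bound:
  assumes m: "0 < m" "m \<le> norm X" "m \<le> norm Y"
  shows "norm (coulomb X - coulomb Y) \<le> 4 * norm (X - Y) / m ^ 3"
proof -
  define a b where "a = norm X" and "b = norm Y"
  have pos: "0 < a" "0 < b" and le: "m \<le> a" "m \<le> b" using m by (auto simp: a_def b_def)
  have "coulomb X - coulomb Y = (X - Y) /\<^sub>R a ^ 3 + (inverse (a ^ 3) - inverse (b ^ 3)) *\<^sub>R Y"
    by (simp add: coulomb_def a_def b_def algebra_simps)
  then have "norm (coulomb X - coulomb Y) \<le> norm (X - Y) / a ^ 3 + \<bar>inverse (a ^ 3) - inverse (b ^ 3)\<bar> * b"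
    using norm_triangle_ineq[of "(X - Y) /\<^sub>R a ^ 3" "(inverse (a ^ 3) - inverse (b ^ 3)) *\<^sub>R Y"] pos
    by (simp add: b_def divide_inverse mult.commute)
  \<comment> \<open>Factorisation of a difference of cubes. Each of the three summands is at most
    \<open>1 / m ^ 3\<close>; together with the term \<open>(X - Y) /\<^sub>R a ^ 3\<close> they
    make the constant 4.\<close>
  also have "(inverse (a ^ 3) - inverse (b ^ 3)) * b
      = (b - a) * (1 / (a * b\<^sup>2) + 1 / (a\<^sup>2 * b) + 1 / a ^ 3)"
    using pos by (simp add: field_simps power2_eq_square power3_eq_cube)
  then have "\<bar>inverse (a ^ 3) - inverse (b ^ 3)\<bar> * b
      = \<bar>b - a\<bar> * (1 / (a * b\<^sup>2) + 1 / (a\<^sup>2 * b) + 1 / a ^ 3)"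
    using pos abs_mult[of "inverse (a ^ 3) - inverse (b ^ 3)" b]
      abs_mult[of "b - a" "1 / (a * b\<^sup>2) + 1 / (a\<^sup>2 * b) + 1 / a ^ 3"] by simp
  also have "\<bar>b - a\<bar> * (1 / (a * b\<^sup>2) + 1 / (a\<^sup>2 * b) + 1 / a ^ 3)
      \<le> norm (X - Y) * (1 / m ^ 3 + 1 / m ^ 3 + 1 / m ^ 3)"
  proof (intro mult_mono add_mono)
    show "\<bar>b - a\<bar> \<le> norm (X - Y)"
      unfolding a_def b_def using norm_triangle_ineq3[of Y X] by (simp add: norm_minus_commute)
    have "m * m\<^sup>2 \<le> a * b\<^sup>2" "m\<^sup>2 * m \<le> a\<^sup>2 * b" "m ^ 3 \<le> a ^ 3"
      using m le by (intro mult_mono power_mono; simp)+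
    then show "1 / (a * b\<^sup>2) \<le> 1 / m ^ 3" "1 / (a\<^sup>2 * b) \<le> 1 / m ^ 3" "1 / a ^ 3 \<le> 1 / m ^ 3"
      using m pos by (auto intro!: divide_left_mono mult_pos_pos zero_less_power simp: power2_eq_square power3_eq_cube)
  qed (use pos in auto)
  also have "norm (X - Y) / a ^ 3 \<le> norm (X - Y) / m ^ 3"
    using m le by (intro divide_left_mono power_mono mult_pos_pos zero_less_power) auto
  finally show ?thesis by (simp add: field_simps)
qed

text \<open>In the splitting used, the factor \<open>norm X\<close> cancels the small denominator,
  so only \<open>norm Y\<close> is left below the line, however close \<open>X\<close> is to
  0.\<close>

lemma norm_sgn_diff:
  fixes X Y :: "'a::real_normed_vector"
  assumes "Y \<noteq> 0"
  shows "norm (sgn X - sgn Y) \<le> 2 * norm (X - Y) / norm Y"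
proof (cases "X = 0")
  case True
  then show ?thesis using assms by (simp add: norm_sgn)
next
  case False
  have "sgn X - sgn Y = (X - Y) /\<^sub>R norm Y + (inverse (norm X) - inverse (norm Y)) *\<^sub>R X"
    by (simp add: sgn_div_norm algebra_simps)
  then have "norm (sgn X - sgn Y) \<le> norm (X - Y) / norm Y + \<bar>inverse (norm X) - inverse (norm Y)\<bar> * norm X"
    using norm_triangle_ineq[of "(X - Y) /\<^sub>R norm Y" "(inverse (norm X) - inverse (norm Y)) *\<^sub>R X"]
    by (simp add: divide_inverse mult.commute)
  also have "\<bar>inverse (norm X) - inverse (norm Y)\<bar> * norm X = \<bar>norm Y - norm X\<bar> / norm Y"
  proof -
    have "(inverse (norm X) - inverse (norm Y)) * norm X = (norm Y - norm X) / norm Y"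
      using assms False by (simp add: field_simps)
    then have "\<bar>(inverse (norm X) - inverse (norm Y)) * norm X\<bar> = \<bar>(norm Y - norm X) / norm Y\<bar>"
      by simp
    then show ?thesis by (simp only: abs_mult abs_divide abs_norm_cancel)
  qed
  also have "\<dots> \<le> norm (X - Y) / norm Y"
    using norm_triangle_ineq3[of Y X] by (intro divide_right_mono) (simp_all add: norm_minus_commute)
  finally show ?thesis by simp
qed

text \<open>The point \<open>(y, s y)\<close> is at least \<open>norm y\<close> away from the origin
  whatever its height. The resulting majorant \<open>1 / r\<^sup>2\<close> is the source of both
  logarithms in the final estimate.\<close>

lemma set_integrable_coulomb_annulus:
  fixes s :: "real^2 \<Rightarrow> real"
  assumes [measurable]: "s \<in> borel_measurable borel" and ab: "0 < a" "a \<le> b"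
  shows "set_integrable lborel (annulus a b) (\<lambda>y. coulomb (y, s y))"
    and "norm (LINT y:annulus a b|lborel. coulomb (y, s y)) \<le> 2 * pi * (ln b - ln a)"
proof -
  have le: "norm (coulomb (y, s y)) \<le> 1 / (norm y)\<^sup>2" if "y \<in> annulus a b" for y
    using that ab norm_fst_le[of y "s y"] unfolding norm_coulomb
    by (intro divide_left_mono power_mono mult_pos_pos zero_less_power) (auto simp: annulus_def)
  note rb = radial_bound[where a = a and b = b and A = "annulus a b" and w = "\<lambda>r. 1 / r\<^sup>2" and \<Phi> = ln,
      OF _ ab(2) _ _ _ _ le]
  show "set_integrable lborel (annulus a b) (\<lambda>y. coulomb (y, s y))"
    by (rule rb)
      (use ab in \<open>auto simp: annulus_def power2_eq_square intro!: derivative_eq_intros\<close>)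
  show "norm (LINT y:annulus a b|lborel. coulomb (y, s y)) \<le> 2 * pi * (ln b - ln a)"
    by (rule rb)
      (use ab in \<open>auto simp: annulus_def power2_eq_square intro!: derivative_eq_intros\<close>)
qed

text \<open>In polar coordinates the integrand is a pure derivative along rays, so only boundary
  terms at the radii \<open>a\<close> and \<open>b\<close> survive, each at most
  \<open>2 * pi\<close> because \<open>\<Psi>\<close> is bounded by 1. The Lipschitz constant
  \<open>M\<close> enters through the domination of the difference quotients and is gone in the
  limit.\<close>

lemma integral_radial_derivative_bound:
  fixes s :: "real^2 \<Rightarrow> real"
  assumes ab: "0 < a" "a < b" and s: "\<And>y. GDERIV s y :> D y"
    and lip: "\<And>y z. \<bar>s y - s z\<bar> \<le> M * norm (y - z)"
    and [measurable]: "D \<in> borel_measurable borel"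
  shows "\<bar>LINT y:annulus a b|lborel. (D y \<bullet> y - s y) / norm (y, s y) ^ 3\<bar> \<le> 4 * pi"
proof -
  define A where "A = (annulus a b :: (real^2) set)"
  define \<Psi> where "\<Psi> y = s y / norm (y, s y)" for y
  define h where "h n = inverse (real (Suc n))" for n
  define Q where "Q n y = indicator A y * ((\<Psi> ((1 + h n) *\<^sub>R y) - \<Psi> y) / h n / (norm y)\<^sup>2)" for n y
  \<comment> \<open>\<open>Q n\<close> is the difference quotient of \<open>\<lambda>c. \<Psi> (c y) / |y|\<^sup>2\<close> at \<open>c = 1\<close>; after the substitution
    \<open>z = c y\<close> only the two boundary layers \<open>S a\<close>, \<open>S b\<close> contribute to its integral over \<open>A\<close>.\<close>
  have h0: "0 < h n" for n by (simp add: h_def)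
  have M: "0 \<le> M" using order_trans[OF abs_ge_zero lip[of 1 0]] by (simp add: zero_le_mult_iff)
  have "continuous_on UNIV s"
    using s by (auto simp: gderiv_def intro!: has_derivative_continuous_on)
  then have [measurable]: "s \<in> borel_measurable borel" by (rule borel_measurable_continuous_onI)
  have [measurable]: "A \<in> sets borel" "\<Psi> \<in> borel_measurable borel"
    unfolding A_def \<Psi>_def by measurable
  have \<Psi>1: "\<bar>\<Psi> y\<bar> \<le> 1" for y
    unfolding \<Psi>_def using norm_snd_le[of "s y" y] by (auto simp: divide_le_eq_1 abs_divide)
  \<comment> \<open>\<open>\<Psi>\<close> is the last component of the unit vector
    \<open>sgn (y, s y)\<close>, so the estimate for normalised vectors applies. The factor
    \<open>h n\<close> makes the bound on \<open>Q n\<close> uniform in \<open>n\<close>.\<close>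
  have \<Psi>lip: "\<bar>\<Psi> ((1 + h n) *\<^sub>R y) - \<Psi> y\<bar> \<le> 2 * (1 + M) * h n" if "y \<noteq> 0" for n y
  proof -
    let ?z = "(1 + h n) *\<^sub>R y"
    have "\<Psi> ?z - \<Psi> y = snd (sgn (?z, s ?z) - sgn (y, s y))"
      by (simp add: \<Psi>_def sgn_div_norm divide_inverse mult.commute)
    also have "\<bar>\<dots>\<bar> \<le> norm (sgn (?z, s ?z) - sgn (y, s y))"
      by (metis norm_snd_le prod.collapse real_norm_def)
    also have "\<dots> \<le> 2 * norm ((?z, s ?z) - (y, s y)) / norm (y, s y)"
      using that by (intro norm_sgn_diff) (auto simp: zero_prod_def)
    also have "(?z, s ?z) - (y, s y) = (h n *\<^sub>R y, s ?z - s y)" by (simp add: algebra_simps)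
    also have "2 * norm (h n *\<^sub>R y, s ?z - s y) / norm (y, s y) \<le> 2 * ((1 + M) * h n * norm y) / norm y"
    proof (intro frac_le mult_left_mono)
      have "norm (h n *\<^sub>R y, s ?z - s y) \<le> norm (h n *\<^sub>R y) + norm (s ?z - s y)" by (rule norm_Pair_le)
      also have "norm (s ?z - s y) \<le> M * norm (h n *\<^sub>R y)"
        using lip[of ?z y] by (simp add: algebra_simps)
      finally show "norm (h n *\<^sub>R y, s ?z - s y) \<le> (1 + M) * h n * norm y"
        using h0[of n] by (simp add: algebra_simps)
    qed (use that M h0[of n] norm_fst_le[of y "s y"] in auto)
    also have "2 * ((1 + M) * h n * norm y) / norm y = 2 * (1 + M) * h n"
      using that by simp
    finally show ?thesis .
  qed
  have lim: "(\<lambda>n. Q n y) \<longlonglongrightarrow> indicator A y * ((D y \<bullet> y - s y) / norm (y, s y) ^ 3)" for y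
  proof (cases "y = 0")
    case True
    then show ?thesis using ab by (simp add: Q_def A_def annulus_def)
  next
    case False
    define q where "q t = s ((1 + t) *\<^sub>R y)" for t
    have q0: "q 0 = s y" by (simp add: q_def)
    have pos: "(norm y)\<^sup>2 + (s y)\<^sup>2 > 0" using False by (simp add: add_pos_nonneg)
    have "((\<lambda>t. (1 + t) *\<^sub>R y) has_derivative (\<lambda>t. t *\<^sub>R y)) (at (0::real))"
      by (auto intro!: derivative_eq_intros)
    moreover have "(s has_derivative (\<lambda>v. v \<bullet> D y)) (at ((1 + 0) *\<^sub>R y))"
      using s[of y] by (simp add: gderiv_def)
    ultimately have "((\<lambda>t. s ((1 + t) *\<^sub>R y)) has_derivative (\<lambda>t. (t *\<^sub>R y) \<bullet> D y)) (at 0)"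
      by (rule has_derivative_compose)
    then have q: "(q has_real_derivative D y \<bullet> y) (at 0)"
      unfolding q_def has_field_derivative_def
      by (rule has_derivative_eq_rhs) (auto simp: inner_commute)
    \<comment> \<open>With \<open>w = norm (y, s y)\<close> the quotient rule leaves \<open>(D y
      \<bullet> y) * (w\<^sup>2 - (s y)\<^sup>2) - s y * (norm y)\<^sup>2\<close> over
      \<open>w ^ 3\<close>; as \<open>w\<^sup>2 - (s y)\<^sup>2 = (norm y)\<^sup>2\<close>, a factor
      \<open>(norm y)\<^sup>2\<close> comes out, which the weight in \<open>Q\<close>
      cancels.\<close>
    have "((\<lambda>t. q t / sqrt (((1 + t) * norm y)\<^sup>2 + (q t)\<^sup>2)) has_real_derivative
        (norm y)\<^sup>2 * ((D y \<bullet> y - s y) / norm (y, s y) ^ 3)) (at 0)"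
    proof -
      define w where "w = norm (y, s y)"
      have w: "sqrt ((norm y)\<^sup>2 + (s y)\<^sup>2) = w" "w > 0" "(norm y)\<^sup>2 = w\<^sup>2 - (s y)\<^sup>2"
        using pos by (auto simp: w_def norm_Pair)
      have ww: "norm y * norm y + s y * s y = w * w"
        using w(3) by (simp add: power2_eq_square)
      have "((\<lambda>t. q t / sqrt (((1 + t) * norm y)\<^sup>2 + (q t)\<^sup>2)) has_real_derivative
          ((D y \<bullet> y) * w - s y * ((2 * (norm y)\<^sup>2 + 2 * s y * (D y \<bullet> y)) * (inverse w / 2))) / (w * w)) (at 0)"
        using pos w(2) ww by (auto intro!: derivative_eq_intros q simp: q0 power2_eq_square algebra_simps)
      also have "((D y \<bullet> y) * w - s y * ((2 * (norm y)\<^sup>2 + 2 * s y * (D y \<bullet> y)) * (inverse w / 2))) / (w * w)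
          = (norm y)\<^sup>2 * ((D y \<bullet> y - s y) / w ^ 3)"
        using w(2) unfolding w(3) by (simp add: field_simps power2_eq_square power3_eq_cube)
      finally show ?thesis by (simp add: w_def)
    qed
    then have "((\<lambda>t. \<Psi> ((1 + t) *\<^sub>R y)) has_real_derivative
        (norm y)\<^sup>2 * ((D y \<bullet> y - s y) / norm (y, s y) ^ 3)) (at 0)"
      unfolding \<Psi>_def q_def by (simp add: norm_Pair power_mult_distrib)
    then have "((\<lambda>t. (\<Psi> ((1 + t) *\<^sub>R y) - \<Psi> y) / t) \<longlongrightarrow>
        (norm y)\<^sup>2 * ((D y \<bullet> y - s y) / norm (y, s y) ^ 3)) (at 0)"
      by (simp add: DERIV_def)
    moreover have "filterlim h (at 0) sequentially"
      unfolding filterlim_at h_def using LIMSEQ_inverse_real_of_nat by auto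
    ultimately have "(\<lambda>n. (\<Psi> ((1 + h n) *\<^sub>R y) - \<Psi> y) / h n) \<longlonglongrightarrow>
        (norm y)\<^sup>2 * ((D y \<bullet> y - s y) / norm (y, s y) ^ 3)"
      by (rule filterlim_compose)
    from tendsto_divide[OF this tendsto_const[of "(norm y)\<^sup>2"]] show ?thesis
      unfolding Q_def using False by (intro tendsto_mult) auto
  qed
  have bound: "norm (Q n y) \<le> indicator A y * (2 * (1 + M) / a\<^sup>2)" for n y
  proof (cases "y \<in> A")
    case True
    then have y: "a < norm y" "y \<noteq> 0" using ab by (auto simp: A_def annulus_def)
    have "\<bar>\<Psi> ((1 + h n) *\<^sub>R y) - \<Psi> y\<bar> / h n / (norm y)\<^sup>2 \<le> 2 * (1 + M) / a\<^sup>2"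
      using y ab h0[of n] M \<Psi>lip[OF y(2), of n]
      by (intro frac_le power_mono) (auto simp: divide_le_eq)
    then show ?thesis using h0[of n] True by (simp add: Q_def abs_mult abs_divide)
  qed (simp add: Q_def)
  have small: "\<bar>LINT y|lborel. Q n y\<bar> \<le> 4 * pi" for n
  proof -
    let ?c = "1 + h n"
    define G where "G B z = indicator B z * (\<Psi> z / (norm z)\<^sup>2)" for B and z :: "real^2"
    define S where "S r = {y::real^2. r \<le> norm y \<and> norm y \<le> ?c * r}" for r
    have [measurable]: "S r \<in> sets borel" for r
      unfolding S_def by (intro borel_closed closed_Collect_conj closed_Collect_le continuous_intros)
    have S: "set_integrable lborel (S r) (\<lambda>y. 1 / (norm y)\<^sup>2)"
        "(LINT y:S r|lborel. 1 / (norm y)\<^sup>2) \<le> 2 * pi * h n" if r: "0 < r" for r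
    proof -
      note rb = radial_bound[where a = r and b = "?c * r" and A = "S r" and w = "\<lambda>r. 1 / r\<^sup>2"
          and \<Phi> = ln and F = "\<lambda>y. 1 / (norm y)\<^sup>2"]
      show "set_integrable lborel (S r) (\<lambda>y. 1 / (norm y)\<^sup>2)"
        by (rule rb) (use r h0[of n] in \<open>auto simp: S_def power2_eq_square intro!: derivative_eq_intros\<close>)
      have "\<bar>LINT y:S r|lborel. 1 / (norm y)\<^sup>2\<bar> \<le> 2 * pi * (ln (?c * r) - ln r)"
        unfolding real_norm_def[symmetric]
        by (rule rb) (use r h0[of n] in \<open>auto simp: S_def power2_eq_square intro!: derivative_eq_intros\<close>)
      also have "ln (?c * r) - ln r = ln ?c" using r h0[of n] by (simp add: ln_mult)
      \<comment> \<open>Each layer thus has weight at most \<open>2 * pi * h n\<close>; dividing by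
        the step \<open>h n\<close> leaves \<open>2 * pi\<close> per layer.\<close>
      also have "\<dots> \<le> h n" using h0[of n] ln_add_one_self_le_self[of "h n"] by simp
      finally show "(LINT y:S r|lborel. 1 / (norm y)\<^sup>2) \<le> 2 * pi * h n" by simp
    qed
    have intG: "integrable lborel (G (annulus r q))" if "0 < r" "r \<le> q" for r q
    proof -
      have "set_integrable lborel (annulus r q) (\<lambda>z. \<Psi> z / (norm z)\<^sup>2)"
        by (rule radial_bound[where a = r and b = q and w = "\<lambda>r. 1 / r\<^sup>2" and \<Phi> = ln])
          (use that \<Psi>1 in \<open>auto simp: annulus_def power2_eq_square abs_divide abs_mult
            intro!: derivative_eq_intros divide_right_mono\<close>)
      then show ?thesis unfolding G_def set_integrable_def by simp
    qed
    have Gm: "G (annulus r q) \<in> borel_measurable borel" for r q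
      unfolding G_def by measurable
    have ca: "a < ?c * a" "b < ?c * b" "?c * a < ?c * b" using ab h0[of n] by simp_all
    have GA: "integrable lborel (G A)" and GB: "integrable lborel (G (annulus (?c * a) (?c * b)))"
      unfolding A_def using ab ca by (auto intro!: intG)
    have "integrable lborel (\<lambda>y. ?c\<^sup>2 * G (annulus (?c * a) (?c * b)) (?c *\<^sub>R y))"
      using lborel_integrable_affine[where c = ?c and t = 0 and h = "G (annulus (?c * a) (?c * b))"] GB Gm h0[of n]
      by (auto intro!: integrable_mult_right)
    moreover have "(LINT z|lborel. G (annulus (?c * a) (?c * b)) z)
        = (LINT y|lborel. ?c\<^sup>2 * G (annulus (?c * a) (?c * b)) (?c *\<^sub>R y))"
      using lborel_integral_affine[where c = ?c and t = 0 and h = "G (annulus (?c * a) (?c * b))"] Gm h0[of n]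
      by simp
    \<comment> \<open>The Jacobian of the planar dilation cancels the factor that the dilation
      produces in \<open>1 / (norm y)\<^sup>2\<close>: the weight is scale invariant, and only
      \<open>\<Psi>\<close> and the annulus change.\<close>
    moreover have "(\<lambda>y. ?c\<^sup>2 * G (annulus (?c * a) (?c * b)) (?c *\<^sub>R y))
        = (\<lambda>y. G A y + h n * Q n y)"
    proof
      fix y
      have "?c *\<^sub>R y \<in> annulus (?c * a) (?c * b) \<longleftrightarrow> y \<in> A"
        using h0[of n] by (simp add: A_def annulus_def)
      moreover have "h n * Q n y = indicator A y * ((\<Psi> (?c *\<^sub>R y) - \<Psi> y) / (norm y)\<^sup>2)"
        using h0[of n] by (simp add: Q_def)
      ultimately show "?c\<^sup>2 * G (annulus (?c * a) (?c * b)) (?c *\<^sub>R y) = G A y + h n * Q n y"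
        using h0[of n] unfolding G_def
        by (cases "y = 0") (auto simp: indicator_def power_mult_distrib diff_divide_distrib)
    qed
    ultimately have eq: "(LINT z|lborel. G (annulus (?c * a) (?c * b)) z) = (LINT y|lborel. G A y + h n * Q n y)"
      and "integrable lborel (\<lambda>y. G A y + h n * Q n y)"
      by simp_all
    then have "integrable lborel (\<lambda>y. (1 / h n) * ((G A y + h n * Q n y) - G A y))"
      using GA by (intro integrable_mult_right Bochner_Integration.integrable_diff)
    then have Qint: "integrable lborel (Q n)" using h0[of n] by simp
    have "h n * \<bar>LINT y|lborel. Q n y\<bar> = \<bar>LINT y|lborel. G (annulus (?c * a) (?c * b)) y - G A y\<bar>"
    proof -
      have "(LINT y|lborel. G A y + h n * Q n y) = (LINT y|lborel. G A y) + (LINT y|lborel. h n * Q n y)"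
        using GA Qint by (intro Bochner_Integration.integral_add) auto
      then have "h n * (LINT y|lborel. Q n y) = (LINT y|lborel. G (annulus (?c * a) (?c * b)) y - G A y)"
        using eq GA GB by simp
      then show ?thesis using h0[of n] by (metis abs_mult abs_of_pos)
    qed
    also have "\<dots> \<le> (LINT y|lborel. indicator (S a) y * (1 / (norm y)\<^sup>2) + indicator (S b) y * (1 / (norm y)\<^sup>2))"
      unfolding real_norm_def[symmetric]
    proof (rule Bochner_Integration.integral_norm_bound_integral)
      fix y :: "real^2"
      \<comment> \<open>The layers are closed, so they also contain the spheres that the open annuli
        leave out.\<close>
      have B: "\<bar>indicator (annulus (?c * a) (?c * b)) y - indicator A y\<bar> \<le> indicator (S a) y + (indicator (S b) y :: real)"
        using ca by (auto simp: indicator_def annulus_def A_def S_def)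
      have "norm (G (annulus (?c * a) (?c * b)) y - G A y)
          = \<bar>indicator (annulus (?c * a) (?c * b)) y - indicator A y\<bar> * (\<bar>\<Psi> y\<bar> / (norm y)\<^sup>2)"
        by (simp add: G_def abs_mult abs_divide flip: left_diff_distrib times_divide_eq_right)
      also have "\<dots> \<le> (indicator (S a) y + indicator (S b) y) * (1 / (norm y)\<^sup>2)"
        using B \<Psi>1 by (intro mult_mono divide_right_mono) auto
      finally show "norm (G (annulus (?c * a) (?c * b)) y - G A y)
          \<le> indicator (S a) y * (1 / (norm y)\<^sup>2) + indicator (S b) y * (1 / (norm y)\<^sup>2)"
        by (simp add: algebra_simps)
    qed (use GA GB S ab in \<open>auto simp: set_integrable_def\<close>)
    also have "\<dots> \<le> 2 * pi * h n + 2 * pi * h n"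
      using S[of a] S[of b] ab unfolding set_integrable_def set_lebesgue_integral_def by simp
    finally show ?thesis using h0[of n] by (simp add: field_simps)
  qed
  have "(\<lambda>n. LINT y|lborel. Q n y) \<longlonglongrightarrow> (LINT y|lborel. indicator A y * ((D y \<bullet> y - s y) / norm (y, s y) ^ 3))"
  proof (rule integral_dominated_convergence)
    show "integrable lborel (\<lambda>y::real^2. indicator A y * (2 * (1 + M) / a\<^sup>2))"
    proof (intro integrable_mult_left integrable_real_indicator)
      have "A \<subseteq> ball 0 b" by (auto simp: A_def annulus_def)
      then show "emeasure lborel A < \<infinity>"
        by (intro emeasure_bounded_finite bounded_subset[OF bounded_ball])
    qed simp
  qed (use lim bound in \<open>auto simp: Q_def\<close>)
  then have "(\<lambda>n. \<bar>LINT y|lborel. Q n y\<bar>) \<longlonglongrightarrow> \<bar>LINT y|lborel. indicator A y * ((D y \<bullet> y - s y) / norm (y, s y) ^ 3)\<bar>"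
    by (rule tendsto_rabs)
  then have "\<bar>LINT y|lborel. indicator A y * ((D y \<bullet> y - s y) / norm (y, s y) ^ 3)\<bar> \<le> 4 * pi"
    by (rule LIMSEQ_le_const2) (use small in auto)
  then show ?thesis unfolding set_lebesgue_integral_def A_def by simp
qed

subsection \<open>Planes\<close>

text \<open>For \<open>d = 0\<close> the integrand is odd. Otherwise \<open>\<bar>d\<bar>\<close> is
  the natural length, and three regions contribute \<open>16 * pi\<close>, \<open>4 * pi\<close> and
  \<open>8 * pi\<close>; on the last two the odd field \<open>N0\<close> of the parallel plane
  through the origin is subtracted first. The bound is uniform in the slope \<open>p\<close>, so no
  power of the gradient enters later.\<close>

lemma coulomb_linear_bound:
  fixes p :: "real^2"
  assumes ab: "0 < a" "a < b"
  shows "norm (LINT y:annulus a b|lborel. coulomb (y, d + p \<bullet> y)) \<le> 28 * pi"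
proof (cases "d = 0")
  case True
  then have "(LINT y:annulus a b|lborel. coulomb (y, d + p \<bullet> y)) = 0"
    by (intro set_integral_odd) (auto simp: annulus_def simp flip: coulomb_minus)
  then show ?thesis by simp
next
  case False
  define A where "A = (annulus a b :: (real^2) set)"
  define N where "N y = coulomb (y, d + p \<bullet> y)" for y
  define N0 where "N0 y = coulomb (y, p \<bullet> y)" for y
  \<comment> \<open>\<open>E1\<close>: the surface point is within a multiple of
    \<open>\<bar>d\<bar>\<close> of the origin. \<open>E2\<close>: \<open>y\<close> is small, but a
    steep plane carries the point away. \<open>E3\<close>: \<open>y\<close> itself is far
    out.\<close>
  define E1 where "E1 = {y\<in>A. norm y \<le> \<bar>d\<bar> \<and> \<bar>p \<bullet> y\<bar> \<le> 2 * \<bar>d\<bar>}"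
  define E2 where "E2 = {y\<in>A. norm y \<le> \<bar>d\<bar> \<and> 2 * \<bar>d\<bar> < \<bar>p \<bullet> y\<bar>}"
  define E3 where "E3 = {y\<in>A. \<bar>d\<bar> < norm y}"
  have [measurable]: "A \<in> sets borel" "N \<in> borel_measurable borel" "N0 \<in> borel_measurable borel"
    unfolding A_def N_def N0_def by measurable
  have [measurable]: "E1 \<in> sets borel" "E2 \<in> sets borel" "E3 \<in> sets borel"
    unfolding E1_def E2_def E3_def by measurable
  have intA: "set_integrable lborel A N" "set_integrable lborel A N0"
    unfolding A_def N_def N0_def using ab by (auto intro!: set_integrable_coulomb_annulus)
  have sub: "E1 \<subseteq> A" "E2 \<subseteq> A" "E3 \<subseteq> A" "E2 \<union> E3 \<subseteq> A" by (auto simp: E1_def E2_def E3_def)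
  have int: "set_integrable lborel E N" "set_integrable lborel E N0"
    if "E \<subseteq> A" "E \<in> sets borel" for E
    using that by (auto intro!: set_integrable_subset[OF intA(1)] set_integrable_subset[OF intA(2)])
  have diff: "norm (N y - N0 y) \<le> 4 * \<bar>d\<bar> / m ^ 3"
    if "0 < m" "m \<le> norm (y, d + p \<bullet> y)" "m \<le> norm (y, p \<bullet> y)" for y m
    using coulomb_diff_bound[OF that] by (simp add: N_def N0_def)

  \<comment> \<open>For affine \<open>s\<close> the radial derivative is \<open>- d / |(y, s y)|\<^sup>3\<close>, so it controls \<open>N\<close> wherever
    \<open>|(y, s y)|\<close> is of the order of \<open>d\<close>.\<close>
  have 1: "norm (LINT y:E1|lborel. N y) \<le> 16 * pi"
  proof -
    define q where "q y = \<bar>d\<bar> / norm (y, d + p \<bullet> y) ^ 3" for y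
    have [measurable]: "q \<in> borel_measurable borel" unfolding q_def by measurable
    have q0: "0 \<le> q y" for y by (simp add: q_def)
    have "\<bar>LINT y:A|lborel. (p \<bullet> y - (d + p \<bullet> y)) / norm (y, d + p \<bullet> y) ^ 3\<bar> \<le> 4 * pi"
      unfolding A_def
    proof (rule integral_radial_derivative_bound[where M = "norm p", OF ab])
      show "GDERIV (\<lambda>y. d + p \<bullet> y) y :> p" for y
        unfolding gderiv_def by (auto intro!: derivative_eq_intros simp: inner_commute)
      show "\<bar>(d + p \<bullet> y) - (d + p \<bullet> z)\<bar> \<le> norm p * norm (y - z)" for y z
        using Cauchy_Schwarz_ineq2[of p "y - z"] by (simp add: inner_diff_right)
    qed auto
    \<comment> \<open>The integrand has constant sign, so the bound on the absolute value of its
      integral bounds the integral of \<open>q\<close> itself, and hence that over any part of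
      \<open>A\<close>.\<close>
    also have "(\<lambda>y. (p \<bullet> y - (d + p \<bullet> y)) / norm (y, d + p \<bullet> y) ^ 3) = (\<lambda>y. - sgn d * q y)"
      by (auto simp: q_def sgn_real_def)
    also have "\<bar>LINT y:A|lborel. - sgn d * q y\<bar> = \<bar>LINT y:A|lborel. q y\<bar>"
      using False by (subst set_integral_mult_right) (simp add: abs_mult abs_sgn_eq)
    finally have q4: "(LINT y:A|lborel. q y) \<le> 4 * pi" by simp
    define c where "c = \<bar>d\<bar> / a ^ 3"
    have c: "0 \<le> c" using ab by (simp add: c_def)
    have qint: "set_integrable lborel A q"
    proof (rule radial_bound[where a = a and b = b and w = "\<lambda>r. c" and \<Phi> = "\<lambda>r. c * r\<^sup>2 / 2"])
      fix y assume y: "y \<in> A"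
      then have "a \<le> norm (y, d + p \<bullet> y)"
        using norm_fst_le[of y "d + p \<bullet> y"] by (simp add: A_def annulus_def)
      then show "norm (q y) \<le> c"
        using ab by (auto simp: q_def c_def intro!: divide_left_mono power_mono mult_pos_pos zero_less_power)
    qed (use ab c in \<open>auto simp: A_def annulus_def intro!: derivative_eq_intros\<close>)
    have "norm (LINT y:E1|lborel. N y) \<le> (LINT y:A|lborel. 4 * q y)"
      unfolding set_lebesgue_integral_def
    proof (rule Bochner_Integration.integral_norm_bound_integral)
      fix y
      show "norm (indicator E1 y *\<^sub>R N y) \<le> indicator A y *\<^sub>R (4 * q y)"
      proof (cases "y \<in> E1")
        case True
        then have y: "norm y \<le> \<bar>d\<bar>" "\<bar>p \<bullet> y\<bar> \<le> 2 * \<bar>d\<bar>" and yA: "y \<in> A" by (auto simp: E1_def)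
        let ?n = "norm (y, d + p \<bullet> y)"
        \<comment> \<open>On \<open>E1\<close> the three contributions are at most
          \<open>\<bar>d\<bar>\<close>, \<open>\<bar>d\<bar>\<close> and
          \<open>2 * \<bar>d\<bar>\<close>, whence the factor 4 in front of
          \<open>q\<close>.\<close>
        have "?n \<le> norm y + norm (d + p \<bullet> y)" by (rule norm_Pair_le)
        also have "\<dots> \<le> 4 * \<bar>d\<bar>" using y by simp
        finally have "?n / ?n ^ 3 \<le> 4 * \<bar>d\<bar> / ?n ^ 3" by (intro divide_right_mono) auto
        moreover have "norm (N y) = ?n / ?n ^ 3"
          by (simp add: N_def norm_coulomb power2_eq_square power3_eq_cube)
        ultimately show ?thesis using True yA by (simp add: q_def)
      qed (use q0 in \<open>auto simp: indicator_def\<close>)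
    qed (use int(1)[OF sub(1)] set_integrable_mult_right[OF qint, of 4] in \<open>auto simp: set_integrable_def\<close>)
    also have "\<dots> = 4 * (LINT y:A|lborel. q y)" by simp
    finally show ?thesis using q4 by simp
  qed

  \<comment> \<open>Here both surface points have height at least \<open>\<bar>d\<bar>\<close> in
    modulus, so the fields differ by at most \<open>4 / d\<^sup>2\<close>, on part of a disc of area
    \<open>pi * d\<^sup>2\<close>.\<close>
  have 2: "norm (LINT y:E2|lborel. N y - N0 y) \<le> 4 * pi"
  proof -
    have "norm (LINT y:E2|lborel. N y - N0 y)
        \<le> 2 * pi * (2 / d\<^sup>2 * \<bar>d\<bar>\<^sup>2 - 2 / d\<^sup>2 * 0\<^sup>2)"
    proof (rule radial_bound[where w = "\<lambda>r. 4 / d\<^sup>2" and \<Phi> = "\<lambda>r. 2 / d\<^sup>2 * r\<^sup>2"])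
      fix y assume "y \<in> E2"
      then have y: "norm y \<le> \<bar>d\<bar>" "2 * \<bar>d\<bar> < \<bar>p \<bullet> y\<bar>" by (auto simp: E2_def)
      have "norm (N y - N0 y) \<le> 4 * \<bar>d\<bar> / \<bar>d\<bar> ^ 3"
      proof (rule diff)
        show "\<bar>d\<bar> \<le> norm (y, d + p \<bullet> y)" "\<bar>d\<bar> \<le> norm (y, p \<bullet> y)"
          using y(2) norm_snd_le[of "d + p \<bullet> y" y] norm_snd_le[of "p \<bullet> y" y] by simp_all
      qed (use False in simp)
      then show "norm (N y - N0 y) \<le> 4 / d\<^sup>2"
        using False by (simp add: power2_eq_square power3_eq_cube)
    qed (use False in \<open>auto simp: E2_def A_def power2_eq_square intro!: derivative_eq_intros\<close>)
    also have "\<dots> = 4 * pi" using False by simp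
    finally show ?thesis .
  qed

  have 3: "norm (LINT y:E3|lborel. N y - N0 y) \<le> 8 * pi"
  proof -
    \<comment> \<open>The maxima keep the radii ordered even when \<open>E3\<close> is
      empty.\<close>
    let ?a = "max a \<bar>d\<bar>" and ?b = "max b \<bar>d\<bar>"
    have pos: "0 < ?a" "?a \<le> ?b" using ab by auto
    have "norm (LINT y:E3|lborel. N y - N0 y)
        \<le> 2 * pi * (- (4 * \<bar>d\<bar> / ?b) - - (4 * \<bar>d\<bar> / ?a))"
    proof (rule radial_bound[where w = "\<lambda>r. 4 * \<bar>d\<bar> / r ^ 3" and \<Phi> = "\<lambda>r. - (4 * \<bar>d\<bar> / r)"])
      fix y assume "y \<in> E3"
      then have y: "0 < norm y" using ab by (auto simp: E3_def A_def annulus_def)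
      then show "norm (N y - N0 y) \<le> 4 * \<bar>d\<bar> / norm y ^ 3"
        by (intro diff norm_fst_le)
    next
      fix r assume "?a \<le> r"
      then have "0 < r" using pos by linarith
      then show "((\<lambda>r. - (4 * \<bar>d\<bar> / r)) has_real_derivative r * (4 * \<bar>d\<bar> / r ^ 3)) (at r)"
        by (auto intro!: derivative_eq_intros simp: field_simps power3_eq_cube)
      show "0 \<le> 4 * \<bar>d\<bar> / r ^ 3" using \<open>0 < r\<close> by simp
    qed (use pos in \<open>auto simp: E3_def A_def annulus_def\<close>)
    also have "\<dots> \<le> 2 * pi * (4 * \<bar>d\<bar> / ?a)"
      using pos by (intro mult_left_mono) auto
    also have "4 * \<bar>d\<bar> / ?a \<le> 4" using pos by (simp add: divide_le_eq)
    finally show ?thesis by simp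
  qed

  have odd: "(LINT y:E2 \<union> E3|lborel. N0 y) = 0"
    by (intro set_integral_odd)
      (auto simp: E2_def E3_def A_def annulus_def N0_def simp flip: coulomb_minus)
  have "(LINT y:A|lborel. N y) = (LINT y:E1|lborel. N y) + (LINT y:E2 \<union> E3|lborel. N y)"
  proof -
    have "A = E1 \<union> (E2 \<union> E3)" "E1 \<inter> (E2 \<union> E3) = {}" by (auto simp: E1_def E2_def E3_def)
    then show ?thesis using int(1)[OF sub(1)] int(1)[OF sub(4)] by (simp add: set_integral_Un)
  qed
  also have "(LINT y:E2 \<union> E3|lborel. N y) = (LINT y:E2 \<union> E3|lborel. N y - N0 y)"
    using odd int[OF sub(4)] by (simp add: set_integral_diff)
  also have "\<dots> = (LINT y:E2|lborel. N y - N0 y) + (LINT y:E3|lborel. N y - N0 y)"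
    by (intro set_integral_Un set_integral_diff int sub) (auto simp: E2_def E3_def)
  finally have "norm (LINT y:A|lborel. N y) \<le> norm (LINT y:E1|lborel. N y)
      + (norm (LINT y:E2|lborel. N y - N0 y) + norm (LINT y:E3|lborel. N y - N0 y))"
    by (simp only:) (intro norm_triangle_le add_left_mono norm_triangle_ineq)
  with 1 2 3 show ?thesis unfolding A_def N_def by simp
qed

subsection \<open>Bounds on annuli\<close>

text \<open>Mean value inequality on the ball of radius \<open>norm y\<close> for \<open>s\<close>
  minus its linear part, whose gradient there is at most
  \<open>H * norm y powr \<gamma>\<close>.\<close>

lemma gradient_holder_taylor:
  fixes s :: "'a::euclidean_space \<Rightarrow> real"
  assumes s: "\<And>y. GDERIV s y :> D y" and \<gamma>: "0 < \<gamma>"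
    and D: "\<And>y. norm (D y - D 0) \<le> H * norm y powr \<gamma>" and H: "0 \<le> H"
  shows "\<bar>s y - (s 0 + D 0 \<bullet> y)\<bar> \<le> H * norm y powr (1 + \<gamma>)"
proof -
  define u where "u z = s z - D 0 \<bullet> z" for z
  have "norm (u y - u 0) \<le> H * norm y powr \<gamma> * norm (y - 0)"
  proof (rule differentiable_bound[where S = "cball 0 (norm y)" and f' = "\<lambda>z h. h \<bullet> (D z - D 0)"])
    show "(u has_derivative (\<lambda>h. h \<bullet> (D z - D 0))) (at z within cball 0 (norm y))" for z
    proof -
      have "((\<lambda>z. s z - D 0 \<bullet> z) has_derivative (\<lambda>h. h \<bullet> D z - D 0 \<bullet> h)) (at z)"
        using s[of z] unfolding gderiv_def
        by (intro has_derivative_diff bounded_linear_imp_has_derivative bounded_linear_inner_right)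
      also have "(\<lambda>h. h \<bullet> D z - D 0 \<bullet> h) = (\<lambda>h. h \<bullet> (D z - D 0))"
        by (simp add: inner_diff_right inner_commute[of "D 0"])
      finally show ?thesis
        unfolding u_def by (rule has_derivative_at_withinI)
    qed
    fix z assume z: "z \<in> cball (0::'a) (norm y)"
    show "onorm (\<lambda>h. h \<bullet> (D z - D 0)) \<le> H * norm y powr \<gamma>"
    proof (rule onorm_le)
      fix h :: 'a
      have "norm (D z - D 0) \<le> H * norm y powr \<gamma>"
        using z H \<gamma> by (intro order_trans[OF D] mult_left_mono powr_mono2) auto
      then have "norm h * norm (D z - D 0) \<le> norm h * (H * norm y powr \<gamma>)"
        by (intro mult_left_mono) auto
      then show "norm (h \<bullet> (D z - D 0)) \<le> H * norm y powr \<gamma> * norm h"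
        using Cauchy_Schwarz_ineq2[of h "D z - D 0"] unfolding real_norm_def mult.commute[of "norm h"] by linarith
    qed
  qed auto
  then show ?thesis
    by (simp add: u_def powr_add algebra_simps)
qed

text \<open>Lets a surface be replaced by a model surface: the fields are compared pointwise with
  \<open>m = norm y\<close>, and the error is integrated through its radial majorant.\<close>

lemma coulomb_comparison:
  fixes s s0 :: "real^2 \<Rightarrow> real"
  assumes ab: "0 < a" "a \<le> b"
    and [measurable]: "s \<in> borel_measurable borel" "s0 \<in> borel_measurable borel" "w \<in> borel_measurable borel"
    and d: "\<And>y. y \<in> annulus a b \<Longrightarrow> 4 * \<bar>s y - s0 y\<bar> / norm y ^ 3 \<le> w (norm y)"
    and \<Phi>: "\<And>r. a \<le> r \<Longrightarrow> r \<le> b \<Longrightarrow> (\<Phi> has_real_derivative r * w r) (at r)"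
    and w: "\<And>r. a \<le> r \<Longrightarrow> r \<le> b \<Longrightarrow> 0 \<le> w r"
  shows "norm (LINT y:annulus a b|lborel. coulomb (y, s y))
    \<le> norm (LINT y:annulus a b|lborel. coulomb (y, s0 y)) + 2 * pi * (\<Phi> b - \<Phi> a)"
proof -
  note int = set_integrable_coulomb_annulus(1)[OF _ ab]
  have "norm (LINT y:annulus a b|lborel. coulomb (y, s y) - coulomb (y, s0 y)) \<le> 2 * pi * (\<Phi> b - \<Phi> a)"
  proof (rule radial_bound(2)[where w = w and \<Phi> = \<Phi>])
    fix y :: "real^2" assume y: "y \<in> annulus a b"
    then have "0 < norm y" using ab by (auto simp: annulus_def)
    then have "norm (coulomb (y, s y) - coulomb (y, s0 y)) \<le> 4 * norm ((y, s y) - (y, s0 y)) / norm y ^ 3"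
      by (intro coulomb_diff_bound norm_fst_le)
    then show "norm (coulomb (y, s y) - coulomb (y, s0 y)) \<le> w (norm y)"
      using d[OF y] by simp
  qed (use ab \<Phi> w in \<open>auto simp: annulus_def\<close>)
  also have "(LINT y:annulus a b|lborel. coulomb (y, s y) - coulomb (y, s0 y))
      = (LINT y:annulus a b|lborel. coulomb (y, s y)) - (LINT y:annulus a b|lborel. coulomb (y, s0 y))"
    by (intro set_integral_diff int) auto
  finally show ?thesis
    using norm_triangle_ineq2[of "LINT y:annulus a b|lborel. coulomb (y, s y)" "LINT y:annulus a b|lborel. coulomb (y, s0 y)"]
    by simp
qed

text \<open>The two planes cost \<open>28 * pi\<close> each, the linearisation error near the origin
  \<open>8 * pi / \<gamma>\<close>, and the error against the constant height far out
  \<open>8 * pi\<close>; the middle annulus gives the logarithms.\<close>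

lemma coulomb_annulus_bound:
  fixes s :: "real^2 \<Rightarrow> real"
  assumes s: "\<And>y. GDERIV s y :> D y" and \<gamma>: "0 < \<gamma>"
    and D: "\<And>y. norm (D y - D 0) \<le> H * norm y powr \<gamma>" and H: "0 \<le> H"
    and L: "\<And>y. \<bar>s y - c\<bar> \<le> L"
    and \<epsilon>R: "0 < \<epsilon>" "\<epsilon> < (1 + H) powr (- 1 / \<gamma>)" "1 + L < R"
  shows "norm (LINT y:annulus \<epsilon> R|lborel. coulomb (y, s y))
    \<le> 64 * pi + 8 * pi / \<gamma> + 2 * pi * (ln (1 + L) + ln (1 + H) / \<gamma>)"
proof -
  \<comment> \<open>Chosen so that \<open>H * \<delta> powr \<gamma> \<le> 1\<close> while
    \<open>ln \<delta>\<close> is only logarithmic in \<open>H\<close>; \<open>1 + H\<close> in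
    place of \<open>H\<close> ensures \<open>\<delta> \<le> 1\<close> and covers
    \<open>H = 0\<close>.\<close>
  define \<delta> where "\<delta> = (1 + H) powr (- 1 / \<gamma>)"
  have L0: "0 \<le> L" using L[of 0] by simp
  have \<delta>: "0 < \<delta>" "\<delta> \<le> 1" "\<epsilon> < \<delta>" "ln \<delta> = - ln (1 + H) / \<gamma>"
    using H \<gamma> \<epsilon>R powr_mono[of "- 1 / \<gamma>" 0 "1 + H"] by (auto simp: \<delta>_def ln_powr)
  have "\<delta> powr \<gamma> = (1 + H) powr - 1"
    unfolding \<delta>_def powr_powr using \<gamma> by simp
  then have H\<delta>: "H * \<delta> powr \<gamma> \<le> 1"
    using H by (simp add: powr_minus_divide)
  have "continuous_on UNIV s"
    using s by (auto simp: gderiv_def intro!: has_derivative_continuous_on)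
  then have [measurable]: "s \<in> borel_measurable borel" by (rule borel_measurable_continuous_onI)
  note int = set_integrable_coulomb_annulus(1)
  let ?I = "\<lambda>a b. LINT y:annulus a b|lborel. coulomb (y, s y)"
  have "?I \<epsilon> R = ?I \<epsilon> \<delta> + (?I \<delta> (1 + L) + ?I (1 + L) R)"
  proof -
    have "?I \<epsilon> R = ?I \<epsilon> \<delta> + ?I \<delta> R"
      using \<epsilon>R \<delta> L0 by (intro annulus_integral_split int) auto
    also have "?I \<delta> R = ?I \<delta> (1 + L) + ?I (1 + L) R"
      using \<epsilon>R \<delta> L0 by (intro annulus_integral_split int) auto
    finally show ?thesis .
  qed
  then have "norm (?I \<epsilon> R) \<le> norm (?I \<epsilon> \<delta>) + (norm (?I \<delta> (1 + L)) + norm (?I (1 + L) R))"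
    by (simp only:) (intro norm_triangle_le add_left_mono norm_triangle_ineq)
  moreover have "norm (?I \<epsilon> \<delta>) \<le> 28 * pi + 8 * pi / \<gamma>"
  proof -
    \<comment> \<open>The Taylor error makes the polar majorant
      \<open>4 * H * r powr (\<gamma> - 1)\<close>; integrating it is what produces
      \<open>1 / \<gamma>\<close>.\<close>
    have "norm (?I \<epsilon> \<delta>) \<le> norm (LINT y:annulus \<epsilon> \<delta>|lborel. coulomb (y, s 0 + D 0 \<bullet> y))
        + 2 * pi * (4 * H * \<delta> powr \<gamma> / \<gamma> - 4 * H * \<epsilon> powr \<gamma> / \<gamma>)"
    proof (rule coulomb_comparison[where w = "\<lambda>r. 4 * H * r powr (\<gamma> - 2)" and \<Phi> = "\<lambda>r. 4 * H * r powr \<gamma> / \<gamma>"])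
      fix y :: "real^2" assume "y \<in> annulus \<epsilon> \<delta>"
      then have y: "0 < norm y" using \<epsilon>R by (auto simp: annulus_def)
      have "4 * \<bar>s y - (s 0 + D 0 \<bullet> y)\<bar> / norm y ^ 3 \<le> 4 * (H * norm y powr (1 + \<gamma>)) / norm y ^ 3"
        using gradient_holder_taylor[OF s \<gamma> D H, of y] by (intro divide_right_mono) auto
      also have "norm y powr (1 + \<gamma>) = norm y powr (\<gamma> - 2) * norm y powr 3"
        by (subst powr_add[symmetric]) (simp add: add.commute)
      also have "norm y powr 3 = norm y ^ 3" using y by simp
      finally show "4 * \<bar>s y - (s 0 + D 0 \<bullet> y)\<bar> / norm y ^ 3 \<le> 4 * H * norm y powr (\<gamma> - 2)"
        using y by simp
    next
      fix r assume "\<epsilon> \<le> r"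
      then have r: "0 < r" using \<epsilon>R by simp
      have "r * r powr (\<gamma> - 2) = r powr (\<gamma> - 1)"
        using r by (simp add: powr_mult_base)
      then show "((\<lambda>r. 4 * H * r powr \<gamma> / \<gamma>) has_real_derivative r * (4 * H * r powr (\<gamma> - 2))) (at r)"
        using r \<gamma> by (auto intro!: derivative_eq_intros simp: power2_eq_square powr_diff)
      show "0 \<le> 4 * H * r powr (\<gamma> - 2)" using H by simp
    qed (use \<epsilon>R \<delta> in auto)
    also have "\<dots> \<le> 28 * pi + 2 * pi * (4 * 1 / \<gamma> - 0)"
    proof (intro add_mono mult_left_mono diff_mono divide_right_mono)
      show "4 * H * \<delta> powr \<gamma> \<le> 4 * 1" using H\<delta> by simp
    qed (use coulomb_linear_bound \<epsilon>R \<delta> H \<gamma> in auto)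
    finally show ?thesis by simp
  qed
  moreover have "norm (?I \<delta> (1 + L)) \<le> 2 * pi * (ln (1 + L) + ln (1 + H) / \<gamma>)"
    using set_integrable_coulomb_annulus(2)[of s \<delta> "1 + L"] \<delta> L0 by simp
  moreover have "norm (?I (1 + L) R) \<le> 36 * pi"
  proof -
    \<comment> \<open>The constant height is written as a plane of slope 0 so that the bound for
      planes applies.\<close>
    have "norm (?I (1 + L) R) \<le> norm (LINT y:annulus (1 + L) R|lborel. coulomb (y, c + (0::real^2) \<bullet> y))
        + 2 * pi * (- (4 * L / R) - - (4 * L / (1 + L)))"
    proof (rule coulomb_comparison[where s = s and s0 = "\<lambda>y. c + (0::real^2) \<bullet> y" and w = "\<lambda>r. 4 * L / r ^ 3" and \<Phi> = "\<lambda>r. - (4 * L / r)"])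
      show "4 * \<bar>s y - (c + 0 \<bullet> y)\<bar> / norm y ^ 3 \<le> 4 * L / norm y ^ 3" for y
        using L[of y] by (intro divide_right_mono) auto
      fix r assume "1 + L \<le> r"
      then have "0 < r" using L0 by linarith
      then show "((\<lambda>r. - (4 * L / r)) has_real_derivative r * (4 * L / r ^ 3)) (at r)" "0 \<le> 4 * L / r ^ 3"
        using L0 by (auto intro!: derivative_eq_intros simp: field_simps power3_eq_cube)
    qed (use \<epsilon>R L0 in auto)
    also have "\<dots> \<le> 28 * pi + 2 * pi * 4"
    proof (intro add_mono mult_left_mono)
      have "4 * L / (1 + L) \<le> 4" "0 \<le> 4 * L / R" using L0 \<epsilon>R by (simp_all add: divide_le_eq)
      then show "- (4 * L / R) - - (4 * L / (1 + L)) \<le> 4" by linarith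
    qed (use coulomb_linear_bound[of "1 + L" R c 0] \<epsilon>R L0 in auto)
    finally show ?thesis by simp
  qed
  ultimately show ?thesis by simp
qed

text \<open>The kernel is the Coulomb field plus a vertical radial derivative, whose integral is at
  most \<open>4 * pi\<close>. The slope bound \<open>H\<close> gives integrability and Lipschitz
  continuity without entering the estimate.\<close>

lemma dipole_annulus:
  fixes s :: "real^2 \<Rightarrow> real"
  assumes s: "\<And>y. GDERIV s y :> D y" and DH: "\<And>y. norm (D y) \<le> H"
    and [measurable]: "D \<in> borel_measurable borel" and ab: "0 < a" "a < b"
  shows "set_integrable lborel (annulus a b) (\<lambda>y. (y, D y \<bullet> y) /\<^sub>R norm (y, s y) ^ 3)" (is ?int)
    and "norm (LINT y:annulus a b|lborel. (y, D y \<bullet> y) /\<^sub>R norm (y, s y) ^ 3)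
      \<le> norm (LINT y:annulus a b|lborel. coulomb (y, s y)) + 4 * pi" (is ?bd)
proof -
  define q where "q y = (D y \<bullet> y - s y) / norm (y, s y) ^ 3" for y
  have "continuous_on UNIV s"
    using s by (auto simp: gderiv_def intro!: has_derivative_continuous_on)
  then have [measurable]: "s \<in> borel_measurable borel" by (rule borel_measurable_continuous_onI)
  have [measurable]: "q \<in> borel_measurable borel" unfolding q_def by measurable
  have H: "0 \<le> H" using DH[of 0] norm_ge_zero order_trans by blast
  have lip: "\<bar>s y - s z\<bar> \<le> H * norm (y - z)" for y z
  proof -
    have "norm (s y - s z) \<le> H * norm (y - z)"
    proof (rule differentiable_bound[where S = UNIV and f' = "\<lambda>z h. h \<bullet> D z"])
      show "onorm (\<lambda>h. h \<bullet> D w) \<le> H" for w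
      proof (rule onorm_le)
        show "norm (h \<bullet> D w) \<le> H * norm h" for h
          using Cauchy_Schwarz_ineq2[of h "D w"] mult_left_mono[OF DH[of w], of "norm h"]
          by (simp add: mult.commute)
      qed
    qed (use s in \<open>auto simp: gderiv_def\<close>)
    then show ?thesis by simp
  qed
  have qint: "set_integrable lborel (annulus a b) q"
  proof (rule radial_bound(1)[where a = a and b = b and w = "\<lambda>r. (H + 1) / r\<^sup>2" and \<Phi> = "\<lambda>r. (H + 1) * ln r"])
    fix y :: "real^2" assume "y \<in> annulus a b"
    then have y: "0 < norm y" using ab by (auto simp: annulus_def)
    define n where "n = norm (y, s y)"
    have n: "norm y \<le> n" "\<bar>s y\<bar> \<le> n"
      using norm_fst_le[of y "s y"] norm_snd_le[of "s y" y] by (simp_all add: n_def)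
    with y have n0: "0 < n" by linarith
    have "\<bar>D y \<bullet> y - s y\<bar> \<le> norm (D y) * norm y + n"
      using Cauchy_Schwarz_ineq2[of "D y" y] n by linarith
    also have "\<dots> \<le> H * n + n"
      using DH[of y] n n0 H by (intro add_mono mult_mono) auto
    finally have "norm (q y) \<le> (H * n + n) / n ^ 3"
      using n n0 unfolding q_def n_def[symmetric] by (simp add: abs_divide divide_right_mono)
    also have "\<dots> = (H + 1) / n\<^sup>2" using n0 by (simp add: field_simps power2_eq_square power3_eq_cube)
    also have "\<dots> \<le> (H + 1) / (norm y)\<^sup>2"
    proof (rule frac_le)
      show "(norm y)\<^sup>2 \<le> n\<^sup>2" using n(1) by (intro power_mono) auto
    qed (use y H in auto)
    finally show "norm (q y) \<le> (H + 1) / (norm y)\<^sup>2" .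
  qed (use ab H in \<open>auto simp: annulus_def power2_eq_square intro!: derivative_eq_intros\<close>)
  have lin: "bounded_linear (\<lambda>t::real. (0::real^2, t))"
    by (intro bounded_linear_Pair bounded_linear_zero bounded_linear_ident)
  have Q: "set_integrable lborel (annulus a b) (\<lambda>y. (0::real^2, q y))"
      "(LINT y:annulus a b|lborel. (0::real^2, q y)) = (0, LINT y:annulus a b|lborel. q y)"
    using integrable_bounded_linear[OF lin qint[unfolded set_integrable_def]]
      integral_bounded_linear[OF lin qint[unfolded set_integrable_def]]
    unfolding set_integrable_def set_lebesgue_integral_def by simp_all
  have C: "set_integrable lborel (annulus a b) (\<lambda>y. coulomb (y, s y))"
    using ab by (intro set_integrable_coulomb_annulus) auto
  have eq: "(\<lambda>y. (y, D y \<bullet> y) /\<^sub>R norm (y, s y) ^ 3) = (\<lambda>y. coulomb (y, s y) + (0, q y))"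
    by (auto simp: coulomb_def q_def divide_inverse algebra_simps)
  show ?int unfolding eq using C Q(1) by (rule set_integral_add)
  have "\<bar>LINT y:annulus a b|lborel. q y\<bar> \<le> 4 * pi"
    unfolding q_def using integral_radial_derivative_bound[OF ab s lip] by simp
  moreover have "(LINT y:annulus a b|lborel. (y, D y \<bullet> y) /\<^sub>R norm (y, s y) ^ 3)
      = (LINT y:annulus a b|lborel. coulomb (y, s y)) + (0, LINT y:annulus a b|lborel. q y)"
    unfolding eq Q(2)[symmetric] using C Q(1) by (rule set_integral_add)
  ultimately show ?bd
    by (auto intro!: norm_triangle_le simp: norm_Pair)
qed

subsection \<open>Existence of the principal value\<close>

lemma eventually_radii:
  assumes "0 < c"
  shows "\<forall>\<^sub>F p in at_right 0 \<times>\<^sub>F at_top. 0 < fst p \<and> fst p < (c::real) \<and> d < (snd p :: real)"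
  unfolding eventually_prod_filter
  by (rule exI[of _ "\<lambda>x. x \<in> {0<..<c}"], rule exI[of _ "\<lambda>x. d < x"])
    (use eventually_at_right_real[OF assms] eventually_gt_at_top[of d] in auto)

text \<open>The error is at most the mass \<open>\<alpha>\<close> outside radius \<open>R\<close>
  plus the mass \<open>\<beta>\<close> inside radius \<open>\<epsilon>\<close>, and each tends to 0
  by dominated convergence in one parameter. \<open>\<beta>\<close> is written in terms of
  \<open>inverse \<epsilon>\<close> so that its limit, too, is taken at infinity.\<close>

lemma tendsto_annulus_integral:
  fixes F :: "'a::euclidean_space \<Rightarrow> 'b::{banach, second_countable_topology}"
  assumes int: "integrable lborel F"
  shows "((\<lambda>(\<epsilon>, R). LINT y:annulus \<epsilon> R|lborel. F y) \<longlongrightarrow> (LINT y|lborel. F y)) (at_right 0 \<times>\<^sub>F at_top)"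
proof -
  note [measurable] = borel_measurable_integrable[OF int]
  define \<alpha> where "\<alpha> R = (LINT y|lborel. indicator {y. R \<le> norm y} y * norm (F y))" for R
  define \<beta> where "\<beta> t = (LINT y|lborel. indicator {y. t * norm y \<le> 1} y * norm (F y))" for t
  have int': "integrable lborel (\<lambda>y. indicator A y * norm (F y))" if "A \<in> sets borel" for A
    using integrable_mult_indicator[OF _ integrable_norm[OF int], of A] that by simp
  have [measurable]: "{y::'a. R \<le> norm y} \<in> sets borel" "{y::'a. t * norm y \<le> 1} \<in> sets borel" for R t
    by (intro borel_closed closed_Collect_le continuous_intros)+
  have "(\<alpha> \<longlongrightarrow> (LINT y::'a|lborel. 0)) at_top"
    unfolding \<alpha>_def
  proof (rule integral_dominated_convergence_at_top[where w = "\<lambda>y. norm (F y)"])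
    show "AE y in lborel. ((\<lambda>R. indicator {y. R \<le> norm y} y * norm (F y)) \<longlongrightarrow> 0) at_top"
    proof (intro AE_I2 tendsto_eventually)
      show "\<forall>\<^sub>F R in at_top. indicator {y. R \<le> norm y} y * norm (F y) = 0" for y
        using eventually_gt_at_top[of "norm y"] by eventually_elim simp
    qed
    show "\<forall>\<^sub>F R in at_top. AE y in lborel. norm (indicator {y. R \<le> norm y} y * norm (F y)) \<le> norm (F y)"
      by (intro always_eventually allI AE_I2) (auto simp: indicator_def)
  qed (use int in auto)
  then have \<alpha>: "(\<alpha> \<longlongrightarrow> 0) at_top" by simp
  \<comment> \<open>The origin lies in every inner ball, so convergence of the indicators fails
    there.\<close>
  have "AE y in lborel. y \<noteq> (0::'a)" by (rule AE_lborel_singleton)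
  then have "(\<beta> \<longlongrightarrow> (LINT y::'a|lborel. 0)) at_top"
    unfolding \<beta>_def
  proof (intro integral_dominated_convergence_at_top[where w = "\<lambda>y. norm (F y)"])
    assume "AE y in lborel. y \<noteq> (0::'a)"
    then show "AE y in lborel. ((\<lambda>t. indicator {y. t * norm y \<le> 1} y * norm (F y)) \<longlongrightarrow> 0) at_top"
    proof eventually_elim
      fix y :: 'a assume y: "y \<noteq> 0"
      show "((\<lambda>t. indicator {y. t * norm y \<le> 1} y * norm (F y)) \<longlongrightarrow> 0) at_top"
        by (rule tendsto_eventually, use eventually_gt_at_top[of "1 / norm y"] in eventually_elim)
          (use y in \<open>auto simp: field_simps\<close>)
    qed
    show "\<forall>\<^sub>F t in at_top. AE y in lborel. norm (indicator {y. t * norm y \<le> 1} y * norm (F y)) \<le> norm (F y)"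
      by (intro always_eventually allI AE_I2) (auto simp: indicator_def)
  qed (use int in auto)
  then have "(\<beta> \<longlongrightarrow> 0) at_top" by simp
  then have \<beta>: "((\<lambda>\<epsilon>. \<beta> (inverse \<epsilon>)) \<longlongrightarrow> 0) (at_right 0)"
    using filterlim_compose filterlim_inverse_at_top_right by blast
  have "((\<lambda>p. \<beta> (inverse (fst p)) + \<alpha> (snd p)) \<longlongrightarrow> 0 + 0) (at_right 0 \<times>\<^sub>F at_top)"
    by (intro tendsto_add filterlim_compose[OF \<beta> filterlim_fst] filterlim_compose[OF \<alpha> filterlim_snd])
  then have lim: "((\<lambda>p. \<beta> (inverse (fst p)) + \<alpha> (snd p)) \<longlongrightarrow> 0) (at_right 0 \<times>\<^sub>F at_top)" by simp
  have "((\<lambda>p. (LINT y:annulus (fst p) (snd p)|lborel. F y) - (LINT y|lborel. F y)) \<longlongrightarrow> 0) (at_right 0 \<times>\<^sub>F at_top)"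
  proof (rule Lim_null_comparison[OF _ lim], use eventually_radii[of 1 0, simplified] in eventually_elim)
    fix p :: "real \<times> real" assume p: "0 < fst p \<and> fst p < 1 \<and> 0 < snd p"
    obtain \<epsilon> R where [simp]: "p = (\<epsilon>, R)" by fastforce
    have pos: "0 < \<epsilon>" using p by simp
    have ia: "integrable lborel (\<lambda>y. indicator (annulus \<epsilon> R) y *\<^sub>R F y)"
      using integrable_mult_indicator[OF _ int, of "annulus \<epsilon> R"] by simp
    have "(LINT y:annulus \<epsilon> R|lborel. F y) - (LINT y|lborel. F y)
        = (LINT y|lborel. indicator (annulus \<epsilon> R) y *\<^sub>R F y - F y)"
      unfolding set_lebesgue_integral_def using int ia by simp
    also have "norm \<dots> \<le> (LINT y|lborel. indicator {y. inverse \<epsilon> * norm y \<le> 1} y * norm (F y)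
        + indicator {y. R \<le> norm y} y * norm (F y))"
    proof (rule Bochner_Integration.integral_norm_bound_integral)
      show "norm (indicator (annulus \<epsilon> R) y *\<^sub>R F y - F y)
          \<le> indicator {y. inverse \<epsilon> * norm y \<le> 1} y * norm (F y) + indicator {y. R \<le> norm y} y * norm (F y)" for y
        using pos by (auto simp: indicator_def annulus_def field_simps)
    qed (use int ia int' in auto)
    also have "\<dots> = \<beta> (inverse \<epsilon>) + \<alpha> R"
      unfolding \<alpha>_def \<beta>_def by (intro Bochner_Integration.integral_add int') auto
    finally show "norm ((LINT y:annulus (fst p) (snd p)|lborel. F y) - (LINT y|lborel. F y))
        \<le> \<beta> (inverse (fst p)) + \<alpha> (snd p)" by simp
  qed
  then show ?thesis
    by (subst LIM_zero_iff[symmetric]) (simp add: case_prod_beta)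
qed

lemma integrable_inverse_cube_tail:
  "integrable lborel (\<lambda>y::real^2. indicator {y. 1 \<le> norm y} y * (1 / norm y ^ 3))"
proof (rule integrableI_bounded)
  have [measurable]: "{y::real^2. 1 \<le> norm y} \<in> sets borel"
    by (intro borel_closed closed_Collect_le continuous_intros)
  show "(\<lambda>y::real^2. indicator {y. 1 \<le> norm y} y * (1 / norm y ^ 3)) \<in> borel_measurable lborel"
    by measurable
  have "(\<integral>\<^sup>+y. ennreal (norm (indicator {y::real^2. 1 \<le> norm y} y * (1 / norm y ^ 3))) \<partial>lborel)
      = (\<integral>\<^sup>+y. (ennreal (1 / norm y ^ 3) * indicator {1..} (norm (y::real^2))) \<partial>lborel)"
    by (intro nn_integral_cong) (auto simp: indicator_def)
  also have "\<dots> = (\<integral>\<^sup>+r. ennreal (2 * pi * r) * indicator {0..} r * (ennreal (1 / r ^ 3) * indicator {1..} r) \<partial>lborel)"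
    by (rule nn_integral_radial) measurable
  also have "\<dots> = (\<integral>\<^sup>+r. ennreal (2 * pi / r\<^sup>2) * indicator {1..} r \<partial>lborel)"
    by (intro nn_integral_cong)
      (auto simp: indicator_def power2_eq_square power3_eq_cube simp flip: ennreal_mult')
  also have "\<dots> = ennreal (0 - (- 2 * pi / 1))"
  proof (rule nn_integral_FTC_atLeast)
    show "((\<lambda>r. - 2 * pi / r) has_real_derivative 2 * pi / x\<^sup>2) (at x)" if "1 \<le> x" for x
      using that by (auto intro!: derivative_eq_intros simp: power2_eq_square)
    show "((\<lambda>r. - 2 * pi / r) \<longlongrightarrow> 0) at_top"
      by (intro tendsto_divide_0[OF tendsto_const] filterlim_at_top_imp_at_infinity filterlim_ident)
  qed auto
  finally show "(\<integral>\<^sup>+y. ennreal (norm (indicator {y::real^2. 1 \<le> norm y} y * (1 / norm y ^ 3))) \<partial>lborel) < \<infinity>"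
    by simp
qed

text \<open>As \<open>s 0 \<noteq> 0\<close>, the kernel has no singularity at the origin. At
  infinity the horizontal part becomes integrable once the odd field \<open>N\<close> is subtracted,
  and the vertical part is handled by the square integrability of \<open>D\<close>.\<close>

lemma dipole_pv:
  fixes s :: "real^2 \<Rightarrow> real"
  assumes s: "\<And>y. GDERIV s y :> D y" and DH: "\<And>y. norm (D y) \<le> H"
    and Dc: "continuous_on UNIV D" and s0: "s 0 \<noteq> 0"
    and S: "\<And>y. \<bar>s y\<bar> \<le> S"
    and L2: "integrable lborel (\<lambda>y. (norm (D y))\<^sup>2)"
  shows "\<exists>l. ((\<lambda>(\<epsilon>, R). LINT y:annulus \<epsilon> R|lborel. (y, D y \<bullet> y) /\<^sub>R norm (y, s y) ^ 3) \<longlongrightarrow> l)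
    (at_right 0 \<times>\<^sub>F at_top)"
proof -
  define K where "K y = (y, D y \<bullet> y) /\<^sub>R norm (y, s y) ^ 3" for y
  define N where "N y = (y /\<^sub>R norm (y, 1::real) ^ 3, 0::real)" for y :: "real^2"
  \<comment> \<open>\<open>N\<close> is odd, hence invisible on annuli, and removes the borderline decay of \<open>K\<close>.\<close>
  have sc: "continuous_on UNIV s"
    using s by (auto simp: gderiv_def intro!: has_derivative_continuous_on)
  then have [measurable]: "s \<in> borel_measurable borel" by (rule borel_measurable_continuous_onI)
  have [measurable]: "D \<in> borel_measurable borel" by (rule borel_measurable_continuous_onI[OF Dc])
  have [measurable]: "K \<in> borel_measurable borel" "N \<in> borel_measurable borel"
    unfolding K_def N_def by measurable
  have cont: "continuous_on (cball 0 1) (\<lambda>y. K y - N y)"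
  proof -
    have "norm (y, s y) ^ 3 \<noteq> 0" "norm (y, 1::real) ^ 3 \<noteq> 0" for y
      using s0 by (auto simp: zero_prod_def)
    then show ?thesis unfolding K_def N_def
      by (intro continuous_intros continuous_on_subset[OF sc] continuous_on_subset[OF Dc]) auto
  qed
  have N1: "norm (N y) \<le> 1 / (norm y)\<^sup>2" if "y \<noteq> 0" for y
  proof -
    have "norm (N y) \<le> norm (coulomb (y, 1::real))"
      using norm_fst_le[of "fst (coulomb (y, 1::real))" "snd (coulomb (y, 1::real))"]
      by (simp add: N_def coulomb_def norm_Pair)
    also have "\<dots> \<le> 1 / (norm y)\<^sup>2"
      unfolding norm_coulomb using that norm_fst_le[of y "1::real"]
      by (intro frac_le power_mono) auto
    finally show ?thesis .
  qed
  \<comment> \<open>\<open>4 * (S + 1)\<close> compares the heights \<open>s y\<close> and 1. The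
    vertical entry is at most \<open>norm (D y) / (norm y)\<^sup>2\<close>, split by the inequality
    between products and squares; the extra 1 absorbs the resulting fourth power.\<close>
  have far: "norm (K y - N y) \<le> (4 * (S + 1) + 1) * (1 / norm y ^ 3) + (norm (D y))\<^sup>2" if y: "1 \<le> norm y" for y
  proof -
    have y0: "0 < norm y" using y by linarith
    define X Y where "X = coulomb (y, s y)" and "Y = coulomb (y, 1::real)"
    define n where "n = norm (y, s y)"
    have n: "norm y \<le> n" using norm_fst_le[of y "s y"] by (simp add: n_def)
    have "K y - N y = (fst (X - Y), (D y \<bullet> y) / n ^ 3)"
      by (simp add: K_def N_def X_def Y_def coulomb_def n_def divide_inverse)
    then have "norm (K y - N y) \<le> norm (fst (X - Y)) + norm ((D y \<bullet> y) / n ^ 3)"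
      by (metis norm_Pair_le)
    also have "norm (fst (X - Y)) \<le> norm (X - Y)"
      by (metis norm_fst_le prod.collapse)
    also have "\<dots> \<le> 4 * norm ((y, s y) - (y, 1)) / norm y ^ 3"
      unfolding X_def Y_def by (intro coulomb_diff_bound norm_fst_le y0)
    also have "\<dots> \<le> 4 * (S + 1) / norm y ^ 3"
    proof (intro divide_right_mono)
      have "\<bar>s y - 1\<bar> \<le> S + 1" using S[of y] by linarith
      then show "4 * norm ((y, s y) - (y, 1)) \<le> 4 * (S + 1)" by simp
    qed simp
    also have "norm ((D y \<bullet> y) / n ^ 3) \<le> norm (D y) * norm y / norm y ^ 3"
    proof -
      have "\<bar>D y \<bullet> y\<bar> / n ^ 3 \<le> norm (D y) * norm y / norm y ^ 3"
        using n y0 Cauchy_Schwarz_ineq2[of "D y" y] by (intro frac_le power_mono) auto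
      moreover have "0 < n" using n y0 by linarith
      ultimately show ?thesis by (simp add: abs_divide)
    qed
    also have "norm (D y) * norm y / norm y ^ 3 = norm (D y) * (1 / (norm y)\<^sup>2)"
      using y0 by (simp add: power2_eq_square power3_eq_cube)
    also have "\<dots> \<le> (norm (D y))\<^sup>2 + (1 / (norm y)\<^sup>2)\<^sup>2"
    proof -
      have "0 \<le> norm (D y) * (1 / (norm y)\<^sup>2)" by simp
      then show ?thesis
        using sum_squares_bound[of "norm (D y)" "1 / (norm y)\<^sup>2"] by linarith
    qed
    also have "(1 / (norm y)\<^sup>2)\<^sup>2 \<le> 1 / norm y ^ 3"
      using y y0 power_increasing[of 3 4 "norm y"] by (auto simp: power_divide simp flip: power_mult intro!: divide_left_mono)
    finally show ?thesis by (simp add: algebra_simps add_divide_distrib)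
  qed
  have intKN: "integrable lborel (\<lambda>y. K y - N y)"
  proof (rule Bochner_Integration.integrable_bound)
    show "integrable lborel (\<lambda>y. norm (indicator (cball 0 1) y *\<^sub>R (K y - N y))
        + ((4 * (S + 1) + 1) * (indicator {y. 1 \<le> norm y} y * (1 / norm y ^ 3)) + (norm (D y))\<^sup>2))"
      using L2 by (intro Bochner_Integration.integrable_add integrable_norm integrable_mult_right
          borel_integrable_compact[OF compact_cball cont] integrable_inverse_cube_tail)
    have S0: "0 \<le> S" using S[of 0] by linarith
    show "AE y in lborel. norm (K y - N y) \<le> norm (norm (indicator (cball 0 1) y *\<^sub>R (K y - N y))
        + ((4 * (S + 1) + 1) * (indicator {y. 1 \<le> norm y} y * (1 / norm y ^ 3)) + (norm (D y))\<^sup>2))"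
    proof (rule AE_I2)
      fix y
      show "norm (K y - N y) \<le> norm (norm (indicator (cball 0 1) y *\<^sub>R (K y - N y))
        + ((4 * (S + 1) + 1) * (indicator {y. 1 \<le> norm y} y * (1 / norm y ^ 3)) + (norm (D y))\<^sup>2))"
      proof (cases "norm y \<le> 1")
        case True
        then show ?thesis using S0 by (simp add: indicator_def)
      next
        case False
        then show ?thesis using far[of y] S0 by (simp add: indicator_def)
      qed
    qed
  qed auto
  have intK: "set_integrable lborel (annulus \<epsilon> R) K" if "0 < \<epsilon>" "\<epsilon> < R" for \<epsilon> R
    unfolding K_def using dipole_annulus(1)[OF s DH _ that] by simp
  have intN: "set_integrable lborel (annulus \<epsilon> R) N" if "0 < \<epsilon>" "\<epsilon> < R" for \<epsilon> R
  proof (rule radial_bound(1)[where a = \<epsilon> and b = R and w = "\<lambda>r. 1 / r\<^sup>2" and \<Phi> = ln])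
    show "norm (N y) \<le> 1 / (norm y)\<^sup>2" if "y \<in> annulus \<epsilon> R" for y
      using that \<open>0 < \<epsilon>\<close> by (intro N1) (auto simp: annulus_def)
  qed (use that in \<open>auto simp: annulus_def power2_eq_square intro!: derivative_eq_intros\<close>)
  have eq: "(LINT y:annulus \<epsilon> R|lborel. K y) = (LINT y:annulus \<epsilon> R|lborel. K y - N y)" if "0 < \<epsilon>" "\<epsilon> < R" for \<epsilon> R
  proof -
    have "(LINT y:annulus \<epsilon> R|lborel. N y) = 0"
      by (intro set_integral_odd) (auto simp: annulus_def N_def norm_Pair)
    then show ?thesis using intK[OF that] intN[OF that] by (simp add: set_integral_diff)
  qed
  have "\<forall>\<^sub>F p in at_right 0 \<times>\<^sub>F at_top. (case p of (\<epsilon>, R) \<Rightarrow> LINT y:annulus \<epsilon> R|lborel. K y - N y)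
      = (case p of (\<epsilon>, R) \<Rightarrow> LINT y:annulus \<epsilon> R|lborel. K y)"
    by (rule eventually_mono[OF eventually_radii[of 1 1]]) (auto simp: case_prod_beta eq)
  with tendsto_annulus_integral[OF intKN]
  have "((\<lambda>(\<epsilon>, R). LINT y:annulus \<epsilon> R|lborel. K y) \<longlongrightarrow> (LINT y|lborel. K y - N y)) (at_right 0 \<times>\<^sub>F at_top)"
    by (rule Lim_transform_eventually)
  then show ?thesis unfolding K_def by blast
qed

subsection \<open>The velocity of one interface\<close>

lemma powr_three_halves: "0 \<le> u \<Longrightarrow> u powr (3 / 2) = sqrt u ^ 3"
proof (cases "u = 0")
  case False
  assume "0 \<le> u"
  with False have "sqrt u ^ 3 = (u powr (1 / 2)) powr 3"
    by (simp add: powr_half_sqrt)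
  also have "\<dots> = u powr (3 / 2)" by (simp only: powr_powr) simp
  finally show ?thesis ..
qed simp

lemma velocity_kernel_eq:
  "velocity_kernel h p y = (y, grad h (fst p - y) \<bullet> y) /\<^sub>R norm (y, snd p - h (fst p - y)) ^ 3"
  by (simp add: velocity_kernel_def case_prod_beta powr_three_halves norm_Pair)

text \<open>Shows that the definite description denotes: the gradient is the adjoint of the
  derivative applied to 1, unique because derivatives are.\<close>

lemma GDERIV_grad:
  fixes h :: "'a::euclidean_space \<Rightarrow> real"
  assumes "h differentiable (at x)"
  shows "GDERIV h x :> grad h x"
proof -
  obtain h' where h': "(h has_derivative h') (at x)"
    using assms unfolding differentiable_def by blast
  then have "linear h'" by (rule has_derivative_linear)
  from adjoint_works[OF this, of _ 1] have "GDERIV h x :> adjoint h' 1"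
    using h' unfolding gderiv_def by simp
  then show ?thesis unfolding grad_def
  proof (rule theI)
    fix D assume "GDERIV h x :> D"
    with \<open>GDERIV h x :> adjoint h' 1\<close> have "(\<lambda>v. v \<bullet> D) = (\<lambda>v. v \<bullet> adjoint h' 1)"
      unfolding gderiv_def by (rule has_derivative_unique[rotated])
    then show "D = adjoint h' 1" by (metis vector_eq_ldot)
  qed
qed

lemma pv_integral_eqI:
  assumes "has_pv_integral F l"
  shows "pv_integral F = l"
  unfolding pv_integral_def
proof (rule the_equality)
  have nt: "at_right (0::real) \<times>\<^sub>F (at_top :: real filter) \<noteq> bot"
    by (simp add: prod_filter_eq_bot)
  show "m = l" if "has_pv_integral F m" for m
    using that assms tendsto_unique[OF nt] unfolding has_pv_integral_def by blast
qed (fact assms)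

lemma holder_norm_finite:
  fixes h :: "'a::euclidean_space \<Rightarrow> 'b::real_normed_vector"
  assumes fin: "holder_norm \<gamma> h < \<infinity>"
  defines "H \<equiv> real_of_ereal (holder_norm \<gamma> h)"
  shows "norm (h x) \<le> H" and "norm (h x - h y) \<le> H * norm (x - y) powr \<gamma>"
proof -
  define A where "A = (SUP x. ereal (norm (h x)))"
  define B where "B = (SUP (x, y) \<in> {(x, y). x \<noteq> y}. ereal (norm (h x - h y) / norm (x - y) powr \<gamma>))"
  have AB: "holder_norm \<gamma> h = A + B" by (simp add: holder_norm_def A_def B_def)
  have A: "ereal (norm (h x)) \<le> A" for x unfolding A_def by (rule SUP_upper) simp
  have B: "ereal (norm (h x - h y) / norm (x - y) powr \<gamma>) \<le> B" if "x \<noteq> y" for x y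
    unfolding B_def using that by (intro SUP_upper2[of "(x, y)"]) auto
  \<comment> \<open>A pair of distinct points is needed here, since the supremum over the empty set
    would be minus infinity. With both suprema nonnegative, each is bounded by the finite
    sum.\<close>
  have "0 \<le> B"
  proof -
    obtain b :: 'a where "b \<in> Basis" using nonempty_Basis by blast
    then show ?thesis using order_trans[OF _ B, of 0 b 0] by (auto simp: nonzero_Basis)
  qed
  moreover have "0 \<le> A" using order_trans[OF _ A, of 0 0] by simp
  ultimately obtain a b where ab: "A = ereal a" "B = ereal b" "0 \<le> a" "0 \<le> b"
    using fin unfolding AB by (cases A; cases B) auto
  then have Hab: "H = a + b" by (simp add: H_def AB)
  show "norm (h x) \<le> H" using A[of x] ab by (simp add: Hab)
  show "norm (h x - h y) \<le> H * norm (x - y) powr \<gamma>"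
  proof (cases "x = y")
    case False
    then have "norm (h x - h y) / norm (x - y) powr \<gamma> \<le> H" using B[OF False] ab by (simp add: Hab)
    then show ?thesis using False by (simp add: divide_le_eq)
  qed simp
qed

text \<open>The set where the essential bound fails is null, and open by continuity, hence
  empty.\<close>

lemma Linf_norm_continuous:
  fixes k :: "'a::euclidean_space \<Rightarrow> real"
  assumes k: "continuous_on UNIV k" and fin: "Linf_norm k < \<infinity>"
  shows "\<bar>k x\<bar> \<le> real_of_ereal (Linf_norm k)"
proof -
  define U where "U = (\<lambda>x. ereal (norm (k x))) -` {Linf_norm k <..}"
  have "AE x in lebesgue. x \<notin> U"
    using esssup_AE[where M = lebesgue and f = "\<lambda>x. ereal (norm (k x))"]
    by (auto simp: U_def Linf_norm_def not_less)
  then have "U \<in> null_sets lebesgue" by (simp add: completion.AE_iff_null_sets)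
  then have "negligible U" by (simp add: negligible_iff_null_sets)
  moreover have "open U" unfolding U_def
    by (intro open_vimage continuous_intros k)
  ultimately have "U = {}" using open_not_negligible by blast
  then have "ereal (norm (k x)) \<le> Linf_norm k" by (auto simp: U_def not_less)
  then show ?thesis using fin by (cases "Linf_norm k") auto
qed

text \<open>Fubini: every vertical line meets the graph in a single point.\<close>

lemma AE_off_graph:
  fixes h :: "'a::euclidean_space \<Rightarrow> real"
  assumes [measurable]: "h \<in> borel_measurable borel"
  shows "AE p in lebesgue. snd p \<noteq> h (fst p)"
proof -
  have "AE p in lborel \<Otimes>\<^sub>M lborel. snd p \<noteq> h (fst p)"
  proof (rule lborel_pair.AE_pair_measure)
    show "AE x in lborel. AE y in lborel. snd (x, y) \<noteq> h (fst (x, y))"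
      by (simp add: AE_lborel_singleton)
  qed measurable
  then show ?thesis unfolding lborel_prod by (rule AE_completion)
qed

lemma holder_continuous:
  fixes G :: "'a::real_normed_vector \<Rightarrow> 'b::real_normed_vector"
  assumes hol: "\<And>x y. norm (G x - G y) \<le> H * norm (x - y) powr \<gamma>" and \<gamma>: "0 < \<gamma>"
  shows "continuous_on UNIV G"
proof (intro continuous_at_imp_continuous_on ballI)
  fix x :: 'a
  have "((\<lambda>y. H * norm (y - x) powr \<gamma>) \<longlongrightarrow> H * 0) (at x)"
    using \<gamma> by (intro tendsto_mult tendsto_const tendsto_zero_powrI[where b = \<gamma>]
        tendsto_norm_zero LIM_zero tendsto_ident_at) simp_all
  then have lim: "((\<lambda>y. H * norm (y - x) powr \<gamma>) \<longlongrightarrow> 0) (at x)" by simp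
  have "((\<lambda>y. G y - G x) \<longlongrightarrow> 0) (at x)"
    by (rule Lim_null_comparison[OF always_eventually lim]) (use hol in blast)
  then show "isCont G x" by (simp add: isCont_def LIM_zero_iff)
qed

section \<open>The velocity integral of a single layer\<close>

context
  fixes h :: "real^2 \<Rightarrow> real" and \<gamma> H L :: real
  assumes diff: "\<And>x. h differentiable (at x)" and \<gamma>: "0 < \<gamma>"
    and H: "\<And>x. norm (grad h x) \<le> H"
    and hol: "\<And>x y. norm (grad h x - grad h y) \<le> H * norm (x - y) powr \<gamma>"
    and L: "\<And>x. \<bar>h x\<bar> \<le> L"
    and L2: "integrable lborel (\<lambda>x. (norm (grad h x))\<^sup>2)"
begin

lemma layer_continuous: "continuous_on UNIV h"
  using diff by (intro continuous_at_imp_continuous_on ballI differentiable_imp_continuous_within)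

lemma layer_grad_continuous: "continuous_on UNIV (grad h)"
  by (rule holder_continuous[OF hol \<gamma>])

lemmas layer_measurable [measurable] =
  borel_measurable_continuous_onI[OF layer_continuous] borel_measurable_continuous_onI[OF layer_grad_continuous]

text \<open>The signs from the reflection and from the subtraction cancel, so this gradient is
  exactly the vector in the velocity kernel.\<close>

lemma GDERIV_layer_height: "GDERIV (\<lambda>y. x3 - h (x - y)) y :> grad h (x - y)"
proof -
  have "((\<lambda>y. x - y) has_derivative (\<lambda>v. - v)) (at y)"
    by (auto intro!: derivative_eq_intros)
  then have "((\<lambda>y. h (x - y)) has_derivative (\<lambda>v. (- v) \<bullet> grad h (x - y))) (at y)"
    by (rule has_derivative_compose) (use GDERIV_grad[OF diff] in \<open>simp add: gderiv_def\<close>)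
  from has_derivative_diff[OF has_derivative_const[of x3] this]
  show ?thesis by (simp add: gderiv_def)
qed

text \<open>Off the graph the height difference at \<open>y = 0\<close> is nonzero, so the principal
  value exists. The annulus bounds \<open>64 * pi + ...\<close> and \<open>4 * pi\<close> hold for
  all small inner and large outer radii and pass to the limit. Comparing with the constant height
  \<open>x3\<close> makes them independent of the point.\<close>

lemma layer_pv_bound:
  assumes p: "snd p \<noteq> h (fst p)"
  shows "has_pv_integral (velocity_kernel h p) (pv_integral (velocity_kernel h p))"
    and "norm (pv_integral (velocity_kernel h p))
      \<le> 68 * pi + 8 * pi / \<gamma> + 2 * pi * (ln (1 + L) + ln (1 + H) / \<gamma>)" (is "_ \<le> ?B")
proof -
  obtain x x3 where [simp]: "p = (x, x3)" by fastforce
  define s where "s y = x3 - h (x - y)" for y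
  define D where "D y = grad h (x - y)" for y
  define K where "K y = (y, D y \<bullet> y) /\<^sub>R norm (y, s y) ^ 3" for y
  have K: "velocity_kernel h p = K"
    by (auto simp: velocity_kernel_eq K_def s_def D_def)
  have s: "GDERIV s y :> D y" for y unfolding s_def D_def by (rule GDERIV_layer_height)
  have Dc: "continuous_on UNIV D" unfolding D_def
    by (rule continuous_on_compose2[OF layer_grad_continuous]) (auto intro!: continuous_intros)
  have [measurable]: "D \<in> borel_measurable borel" by (rule borel_measurable_continuous_onI[OF Dc])
  have [measurable]: "s \<in> borel_measurable borel" unfolding s_def by measurable
  have [measurable]: "K \<in> borel_measurable borel" unfolding K_def by measurable
  have DH: "norm (D y) \<le> H" for y unfolding D_def by (rule H)
  have H0: "0 \<le> H" using H[of 0] norm_ge_zero order_trans by blast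
  have "integrable lborel (\<lambda>y. (norm (D y))\<^sup>2)"
    using lborel_integrable_affine[of "-1" "\<lambda>x. (norm (grad h x))\<^sup>2" x] L2 by (simp add: D_def)
  moreover have "\<bar>s y\<bar> \<le> \<bar>x3\<bar> + L" for y
    using L[of "x - y"] by (simp add: s_def)
  moreover have "s 0 \<noteq> 0" using p by (simp add: s_def)
  ultimately obtain l where l: "((\<lambda>(\<epsilon>, R). LINT y:annulus \<epsilon> R|lborel. K y) \<longlongrightarrow> l) (at_right 0 \<times>\<^sub>F at_top)"
    using dipole_pv[OF s DH Dc] unfolding K_def by blast
  have pv: "has_pv_integral K l"
    unfolding has_pv_integral_def
  proof (intro conjI allI impI)
    fix \<epsilon> R :: real assume "0 < \<epsilon> \<and> \<epsilon> < R"
    then have "set_integrable lborel (annulus \<epsilon> R) K"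
      unfolding K_def by (intro dipole_annulus(1)[OF s DH]) auto
    then show "set_integrable lebesgue (annulus \<epsilon> R) K"
      unfolding set_integrable_def by (subst integrable_completion) auto
  next
    have "(LINT y:annulus \<epsilon> R|lebesgue. K y) = (LINT y:annulus \<epsilon> R|lborel. K y)" for \<epsilon> R
      unfolding set_lebesgue_integral_def by (subst integral_completion) auto
    then show "((\<lambda>(\<epsilon>, R). LINT y:annulus \<epsilon> R|lebesgue. K y) \<longlongrightarrow> l) (at_right 0 \<times>\<^sub>F at_top)"
      using l by simp
  qed
  then have eq: "pv_integral K = l" by (rule pv_integral_eqI)
  show "has_pv_integral (velocity_kernel h p) (pv_integral (velocity_kernel h p))"
    unfolding K eq by (rule pv)
  have "norm l \<le> ?B"
  proof (rule Lim_norm_ubound[OF _ l])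
    show "at_right (0::real) \<times>\<^sub>F (at_top :: real filter) \<noteq> bot"
      by (simp add: prod_filter_eq_bot)
    have L0: "0 \<le> L" using L[of 0] by simp
    have d: "0 < (1 + H) powr (- 1 / \<gamma>)" "(1 + H) powr (- 1 / \<gamma>) \<le> 1"
      using H0 \<gamma> powr_mono[of "- 1 / \<gamma>" 0 "1 + H"] by auto
    from eventually_radii[OF d(1), of "1 + L"]
    show "\<forall>\<^sub>F p in at_right 0 \<times>\<^sub>F at_top. norm (case p of (\<epsilon>, R) \<Rightarrow> LINT y:annulus \<epsilon> R|lborel. K y) \<le> ?B"
    proof eventually_elim
      fix p :: "real \<times> real"
      assume p: "0 < fst p \<and> fst p < (1 + H) powr (- 1 / \<gamma>) \<and> 1 + L < snd p"
      obtain \<epsilon> R where [simp]: "p = (\<epsilon>, R)" by fastforce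
      have \<epsilon>R: "0 < \<epsilon>" "\<epsilon> < (1 + H) powr (- 1 / \<gamma>)" "1 + L < R" using p by auto
      have "norm (LINT y:annulus \<epsilon> R|lborel. coulomb (y, s y))
          \<le> 64 * pi + 8 * pi / \<gamma> + 2 * pi * (ln (1 + L) + ln (1 + H) / \<gamma>)"
      proof (rule coulomb_annulus_bound[OF s \<gamma> _ H0 _ \<epsilon>R])
        show "norm (D y - D 0) \<le> H * norm y powr \<gamma>" for y
          using hol[of "x - y" x] by (simp add: D_def)
        show "\<bar>s y - x3\<bar> \<le> L" for y using L[of "x - y"] by (simp add: s_def)
      qed
      moreover have "norm (LINT y:annulus \<epsilon> R|lborel. K y)
          \<le> norm (LINT y:annulus \<epsilon> R|lborel. coulomb (y, s y)) + 4 * pi"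
        unfolding K_def using \<epsilon>R d L0 by (intro dipole_annulus(2)[OF s DH]) auto
      ultimately show "norm (case p of (\<epsilon>, R) \<Rightarrow> LINT y:annulus \<epsilon> R|lborel. K y) \<le> ?B" by simp
    qed
  qed
  then show "norm (pv_integral (velocity_kernel h p)) \<le> ?B"
    unfolding K eq by simp
qed

text \<open>Needed for the estimate of the essential supremum. Off the graph the principal value is
  a limit of parameter integrals that are Borel in \<open>p\<close>; the graph is null and the
  Lebesgue measure complete.\<close>

lemma layer_pv_measurable:
  "(\<lambda>p. pv_integral (velocity_kernel h p)) \<in> borel_measurable lebesgue"
proof -
  \<comment> \<open>One sequence of radii along the product filter is enough, because the limit is
    already known to exist.\<close>
  define u where "u n p = (LINT y:annulus (inverse (real (Suc n))) (real n)|lborel. velocity_kernel h p y)" for n p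
  have [measurable]: "u n \<in> borel_measurable borel" for n
  proof -
    let ?M = "borel :: (((real^2) \<times> real) \<times> (real^2)) measure"
    have c [measurable]: "(\<lambda>q. fst (fst q) - snd q) \<in> ?M \<rightarrow>\<^sub>M borel"
          "(\<lambda>q. snd (fst q)) \<in> ?M \<rightarrow>\<^sub>M borel" "snd \<in> ?M \<rightarrow>\<^sub>M borel"
        by (intro borel_measurable_continuous_onI continuous_intros)+
      have [measurable]: "(\<lambda>q. h (fst (fst q) - snd q)) \<in> ?M \<rightarrow>\<^sub>M borel"
          "(\<lambda>q. grad h (fst (fst q) - snd q)) \<in> ?M \<rightarrow>\<^sub>M borel"
          "(\<lambda>q. indicator (annulus (inverse (real (Suc n))) (real n)) (snd q) :: real) \<in> ?M \<rightarrow>\<^sub>M borel"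
        using measurable_compose[OF c(1)] measurable_compose[OF c(3)] layer_measurable by auto
      have "(\<lambda>(p, y). indicator (annulus (inverse (real (Suc n))) (real n)) y *\<^sub>R
            ((y, grad h (fst p - y) \<bullet> y) /\<^sub>R norm (y, snd p - h (fst p - y)) ^ 3))
          \<in> ?M \<rightarrow>\<^sub>M borel"
        unfolding case_prod_beta by measurable
      then have "(\<lambda>(p, y). indicator (annulus (inverse (real (Suc n))) (real n)) y *\<^sub>R
            ((y, grad h (fst p - y) \<bullet> y) /\<^sub>R norm (y, snd p - h (fst p - y)) ^ 3))
          \<in> borel_measurable (borel \<Otimes>\<^sub>M lborel)"
        by (simp flip: borel_prod)
      from lborel.borel_measurable_lebesgue_integral[OF this] show ?thesis
        unfolding u_def set_lebesgue_integral_def velocity_kernel_eq .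
  qed
  have lim: "(\<lambda>n. u n p) \<longlonglongrightarrow> pv_integral (velocity_kernel h p)" if p: "snd p \<noteq> h (fst p)" for p
  proof -
    have "filterlim (\<lambda>n. (inverse (real (Suc n)), real n)) (at_right 0 \<times>\<^sub>F at_top) sequentially"
    proof (rule filterlim_Pair)
      show "filterlim (\<lambda>n. inverse (real (Suc n))) (at_right 0) sequentially"
        unfolding filterlim_at using LIMSEQ_inverse_real_of_nat by auto
    qed (rule filterlim_real_sequentially)
    from filterlim_compose[OF conjunct2[OF layer_pv_bound(1)[OF p, unfolded has_pv_integral_def]] this]
    have "(\<lambda>n. LINT y:annulus (inverse (real (Suc n))) (real n)|lebesgue. velocity_kernel h p y)
        \<longlonglongrightarrow> pv_integral (velocity_kernel h p)" by simp
    moreover have "(LINT y:annulus (inverse (real (Suc n))) (real n)|lebesgue. velocity_kernel h p y) = u n p" for n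
      unfolding u_def set_lebesgue_integral_def velocity_kernel_eq
      by (rule integral_completion) measurable
    ultimately show ?thesis by simp
  qed
  have "(\<lambda>p. lim (\<lambda>n. u n p)) \<in> borel_measurable lborel"
    by (rule borel_measurable_lim_metric) simp
  then have "(\<lambda>p. lim (\<lambda>n. u n p)) \<in> borel_measurable lebesgue"
    by (rule measurable_completion)
  then show ?thesis
  proof (rule borel_measurable_AE)
    show "AE p in lebesgue. lim (\<lambda>n. u n p) = pv_integral (velocity_kernel h p)"
      using AE_off_graph[OF layer_measurable(1)] by eventually_elim (rule limI[OF lim])
  qed
qed

end

section \<open>Assembling the two layers\<close>

lemma L2_norm_finite:
  fixes h :: "'a::euclidean_space \<Rightarrow> 'b::euclidean_space"
  assumes fin: "L2_norm h < \<infinity>" and [measurable]: "h \<in> borel_measurable borel"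
  shows "integrable lborel (\<lambda>x. (norm (h x))\<^sup>2)" and "0 \<le> real_of_ereal (L2_norm h)"
proof -
  have "integrable lebesgue (\<lambda>x. (norm (h x))\<^sup>2)"
    using fin by (auto simp: L2_norm_def split: if_splits)
  then show "integrable lborel (\<lambda>x. (norm (h x))\<^sup>2)"
    by (subst (asm) integrable_completion) auto
  show "0 \<le> real_of_ereal (L2_norm h)" by (simp add: L2_norm_def)
qed

theorem lemma4p1:
  fixes \<rho>1 \<rho>2 \<rho>3 :: real
  assumes "\<rho>1 < \<rho>2" and "\<rho>2 < \<rho>3"
  shows "\<exists>C::real. \<forall>(\<gamma>::real) (Cinf::real) (I::real set)
      (f :: real \<Rightarrow> real^2 \<Rightarrow> real) (g :: real \<Rightarrow> real^2 \<Rightarrow> real).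
    0 < \<gamma> \<longrightarrow> \<gamma> < 1 \<longrightarrow>
    contour_solution \<rho>1 \<rho>2 \<rho>3 I f g \<longrightarrow>
    (\<forall>t\<in>I. \<forall>x. g t x < f t x) \<longrightarrow>
    (\<forall>t\<in>I. (f t \<longlongrightarrow> Cinf) at_infinity \<and> (g t \<longlongrightarrow> 0) at_infinity) \<longrightarrow>
    (\<forall>t\<in>I.
      holder_norm \<gamma> (grad (f t)) < \<infinity> \<longrightarrow> holder_norm \<gamma> (grad (g t)) < \<infinity> \<longrightarrow>
      Linf_norm (\<lambda>x. f t x - Cinf) < \<infinity> \<longrightarrow> L2_norm (grad (f t)) < \<infinity> \<longrightarrow>
      Linf_norm (g t) < \<infinity> \<longrightarrow> L2_norm (grad (g t)) < \<infinity> \<longrightarrow>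
      Linf_norm (velocity \<rho>1 \<rho>2 \<rho>3 (f t) (g t)) \<le>
        ereal (C * (1 + 1 / \<gamma>
          + 1 / \<gamma> * ln (1 + real_of_ereal (holder_norm \<gamma> (grad (f t)))
                         + real_of_ereal (holder_norm \<gamma> (grad (g t))))
          + ln (1 + real_of_ereal (Linf_norm (\<lambda>x. f t x - Cinf)) + Cinf
                  + real_of_ereal (L2_norm (grad (f t)))
                  + real_of_ereal (Linf_norm (g t))
                  + real_of_ereal (L2_norm (grad (g t)))))))"
\<comment> \<open>Each layer is bounded by \<open>68 * pi\<close> times the bracket; the prefactors
  \<open>1 / (4 * pi)\<close> leave 17, and the two density jumps add up to
  \<open>\<rho>3 - \<rho>1\<close>.\<close>
proof (intro exI[of _ "17 * (\<rho>3 - \<rho>1)"] allI impI ballI)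
  fix \<gamma> Cinf :: real and I :: "real set" and f g :: "real \<Rightarrow> real^2 \<Rightarrow> real" and t :: real
  assume \<gamma>: "0 < \<gamma>" "\<gamma> < 1" and sol: "contour_solution \<rho>1 \<rho>2 \<rho>3 I f g"
    and less: "\<forall>t\<in>I. \<forall>x. g t x < f t x"
    and lim: "\<forall>t\<in>I. (f t \<longlongrightarrow> Cinf) at_infinity \<and> (g t \<longlongrightarrow> 0) at_infinity"
    and t: "t \<in> I"
    and fin: "holder_norm \<gamma> (grad (f t)) < \<infinity>" "holder_norm \<gamma> (grad (g t)) < \<infinity>"
      "Linf_norm (\<lambda>x. f t x - Cinf) < \<infinity>" "L2_norm (grad (f t)) < \<infinity>"
      "Linf_norm (g t) < \<infinity>" "L2_norm (grad (g t)) < \<infinity>"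
  define Hf where "Hf = real_of_ereal (holder_norm \<gamma> (grad (f t)))"
  define Hg where "Hg = real_of_ereal (holder_norm \<gamma> (grad (g t)))"
  define Lf where "Lf = real_of_ereal (Linf_norm (\<lambda>x. f t x - Cinf))"
  define Lg where "Lg = real_of_ereal (Linf_norm (g t))"
  define Nf where "Nf = real_of_ereal (L2_norm (grad (f t)))"
  define Ng where "Ng = real_of_ereal (L2_norm (grad (g t)))"
  define X where "X = 1 + 1 / \<gamma> + 1 / \<gamma> * ln (1 + Hf + Hg) + ln (1 + Lf + Cinf + Nf + Lg + Ng)"
  have diff: "f t differentiable (at x)" "g t differentiable (at x)" for x
    using sol t by (auto simp: contour_solution_def)
  note hol_f = holder_norm_finite[OF fin(1), folded Hf_def]
  note hol_g = holder_norm_finite[OF fin(2), folded Hg_def]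
  have contf: "continuous_on UNIV (f t)" and contg: "continuous_on UNIV (g t)"
    using diff by (auto intro!: continuous_at_imp_continuous_on differentiable_imp_continuous_within)
  have Lf: "\<bar>f t x - Cinf\<bar> \<le> Lf" for x
    unfolding Lf_def by (rule Linf_norm_continuous[OF _ fin(3)]) (intro continuous_intros contf)
  have Lg: "\<bar>g t x\<bar> \<le> Lg" for x
    unfolding Lg_def by (rule Linf_norm_continuous[OF contg fin(5)])
  \<comment> \<open>The ordering of the surfaces passes to the limit at infinity. This allows
    \<open>Cinf\<close> without absolute value in the bound on \<open>f t\<close> and keeps the
    argument of the last logarithm at least 1.\<close>
  have Cinf: "0 \<le> Cinf"
    by (rule tendsto_le[of at_infinity "f t" Cinf "g t" 0])
      (use lim less t in \<open>auto intro!: always_eventually less_imp_le simp: trivial_limit_at_infinity\<close>)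
  have Lf': "\<bar>f t x\<bar> \<le> Lf + Cinf" for x using Lf[of x] Cinf by linarith
  have meas: "grad (f t) \<in> borel_measurable borel" "grad (g t) \<in> borel_measurable borel"
    using holder_continuous[OF hol_f(2) \<gamma>(1)] holder_continuous[OF hol_g(2) \<gamma>(1)]
    by (auto intro: borel_measurable_continuous_onI)
  note N = L2_norm_finite[OF fin(4) meas(1), folded Nf_def] L2_norm_finite[OF fin(6) meas(2), folded Ng_def]
  have nonneg: "0 \<le> Hf" "0 \<le> Hg" "0 \<le> Lf" "0 \<le> Lg"
    using order_trans[OF norm_ge_zero hol_f(1)] order_trans[OF norm_ge_zero hol_g(1)]
      order_trans[OF abs_ge_zero Lf] order_trans[OF abs_ge_zero Lg] by auto
  note layer_f = layer_pv_bound[OF diff(1) \<gamma>(1) hol_f Lf' N(1)]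
  note layer_g = layer_pv_bound[OF diff(2) \<gamma>(1) hol_g Lg N(3)]
  have [measurable]: "(\<lambda>p. pv_integral (velocity_kernel (f t) p)) \<in> borel_measurable lebesgue"
      "(\<lambda>p. pv_integral (velocity_kernel (g t) p)) \<in> borel_measurable lebesgue"
    by (rule layer_pv_measurable[OF diff(1) \<gamma>(1) hol_f Lf' N(1)] layer_pv_measurable[OF diff(2) \<gamma>(1) hol_g Lg N(3)])+
  \<comment> \<open>Every term on the left is a multiple, by at most \<open>68 * pi\<close>, of a
    quantity dominated by one of the four nonnegative summands of \<open>X\<close>.\<close>
  have bound: "68 * pi + 8 * pi / \<gamma> + 2 * pi * (ln (1 + L) + ln (1 + H) / \<gamma>) \<le> 68 * pi * X"
    if "0 \<le> L" "L \<le> Lf + Cinf + Nf + Lg + Ng" "0 \<le> H" "H \<le> Hf + Hg" for L H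
  proof -
    have "ln (1 + L) \<le> ln (1 + Lf + Cinf + Nf + Lg + Ng)" "ln (1 + H) / \<gamma> \<le> 1 / \<gamma> * ln (1 + Hf + Hg)"
      "0 \<le> ln (1 + L)" "0 \<le> ln (1 + H) / \<gamma>" "0 \<le> 1 / \<gamma>"
      using that \<gamma> by (auto intro!: divide_right_mono)
    then have "68 + 8 * (1 / \<gamma>) + 2 * (ln (1 + L) + ln (1 + H) / \<gamma>) \<le> 68 * X"
      unfolding X_def by argo
    from mult_left_mono[OF this, of pi] show ?thesis by (simp add: algebra_simps)
  qed
  have Bf: "norm (pv_integral (velocity_kernel (f t) p)) \<le> 68 * pi * X" if "snd p \<noteq> f t (fst p)" for p
    by (rule order_trans[OF layer_f(2)[OF that] bound]) (use nonneg Cinf N in auto)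
  have Bg: "norm (pv_integral (velocity_kernel (g t) p)) \<le> 68 * pi * X" if "snd p \<noteq> g t (fst p)" for p
    by (rule order_trans[OF layer_g(2)[OF that] bound]) (use nonneg Cinf N in auto)
  have "Linf_norm (velocity \<rho>1 \<rho>2 \<rho>3 (f t) (g t)) \<le> ereal (17 * (\<rho>3 - \<rho>1) * X)"
    unfolding Linf_norm_def
  proof (rule esssup_I)
    show "(\<lambda>p. ereal (norm (velocity \<rho>1 \<rho>2 \<rho>3 (f t) (g t) p))) \<in> borel_measurable lebesgue"
      unfolding velocity_def by measurable
    have "AE p in lebesgue. snd p \<noteq> f t (fst p)" "AE p in lebesgue. snd p \<noteq> g t (fst p)"
      using contf contg by (auto intro!: AE_off_graph borel_measurable_continuous_onI)
    then show "AE p in lebesgue. ereal (norm (velocity \<rho>1 \<rho>2 \<rho>3 (f t) (g t) p)) \<le> ereal (17 * (\<rho>3 - \<rho>1) * X)"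
    proof eventually_elim
      fix p assume p: "snd p \<noteq> f t (fst p)" "snd p \<noteq> g t (fst p)"
      let ?a = "(\<rho>2 - \<rho>1) / (4 * pi)" and ?b = "(\<rho>3 - \<rho>2) / (4 * pi)"
      have ab: "0 \<le> ?a" "0 \<le> ?b" using assms by auto
      have "norm (velocity \<rho>1 \<rho>2 \<rho>3 (f t) (g t) p)
          \<le> norm (- ?a *\<^sub>R pv_integral (velocity_kernel (f t) p)) + norm (?b *\<^sub>R pv_integral (velocity_kernel (g t) p))"
        unfolding velocity_def by (rule norm_triangle_ineq4)
      also have "\<dots> \<le> ?a * (68 * pi * X) + ?b * (68 * pi * X)"
        using ab Bf[OF p(1)] Bg[OF p(2)] unfolding norm_scaleR by (intro add_mono mult_mono) auto
      also have "\<dots> = 17 * (\<rho>3 - \<rho>1) * X" by (simp add: field_simps)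
      finally show "ereal (norm (velocity \<rho>1 \<rho>2 \<rho>3 (f t) (g t) p)) \<le> ereal (17 * (\<rho>3 - \<rho>1) * X)"
        by simp
    qed
  qed
  then show "Linf_norm (velocity \<rho>1 \<rho>2 \<rho>3 (f t) (g t)) \<le>
        ereal (17 * (\<rho>3 - \<rho>1) * (1 + 1 / \<gamma>
          + 1 / \<gamma> * ln (1 + real_of_ereal (holder_norm \<gamma> (grad (f t)))
                         + real_of_ereal (holder_norm \<gamma> (grad (g t))))
          + ln (1 + real_of_ereal (Linf_norm (\<lambda>x. f t x - Cinf)) + Cinf
                  + real_of_ereal (L2_norm (grad (f t)))
                  + real_of_ereal (Linf_norm (g t))
                  + real_of_ereal (L2_norm (grad (g t))))))"
    unfolding X_def Hf_def Hg_def Lf_def Lg_def Nf_def Ng_def .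
qed

end
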